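(* There is an algorithm that solves the Fair Max-Min diversification problem exactly when the points can be embedded on a line, in running time $O\big(n^4\prod_{i=1}^m(k_i+1)\big)$. That is, given $\mathcal{X}\subset\mathbb{R}$ with $|\mathcal{X}|=n$ and $d(x,y)=|x-y|$, partitioned into groups $\mathcal{X}_1,\dots,\mathcal{X}_m$, and integers $k_1,\dots,k_m$, the algorithm returns within this time a set $\mathcal{S}\subseteq\mathcal{X}$ with $|\mathcal{S}\cap\mathcal{X}_i|=k_i$ for all $i\in[m]$ and $\mathrm{div}(\mathcal{S})=\ell^*$.
   Context: Fair Max-Min diversification: the input is a finite metric space $(\mathcal{X},d)$ with $|\mathcal{X}|=n$, where $\mathcal{X}=\bigcup_{i=1}^m\mathcal{X}_i$ is partitioned into $m$ disjoint groups, and non-negative integers $k_1,\dots,k_m$ with $k_i\le|\mathcal{X}_i|$. For $\mathcal{S}\subseteq\mathcal{X}$ let $\mathrm{div}(\mathcal{S})=\min_{u,v\in\mathcal{S},u\ne v}d(u,v)$ (the minimum over the empty set is $+\infty$). The optimal diversity is $\ell^*=\max\{\mathrm{div}(\mathcal{S}):\mathcal{S}\subseteq\mathcal{X},\ |\mathcal{S}\cap\mathcal{X}_i|=k_i\ \forall i\in[m]\}$. *)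

theory Defs
  imports "HOL-Analysis.Analysis"
begin

section \<open>Fair Max-Min diversification\<close>

text \<open>Values are extended reals, so the infimum over the empty set of pairs is \<open>\<infinity>\<close>; for a
  finite set with at least two elements the infimum is attained.\<close>

definition diversity :: "'a::metric_space set \<Rightarrow> ereal" where
  "diversity S = (INF (u, v) \<in> {(u, v). u \<in> S \<and> v \<in> S \<and> u \<noteq> v}. ereal (dist u v))"

text \<open>The groups are \<open>G 0, \<dots>, G (m - 1)\<close>; values of \<open>G\<close> and \<open>k\<close> beyond that range are irrelevant.
  Groups may be empty.\<close>

definition fair_instance :: "nat \<Rightarrow> 'a::metric_space set \<Rightarrow> (nat \<Rightarrow> 'a set) \<Rightarrow> (nat \<Rightarrow> nat) \<Rightarrow> bool" where
  "fair_instance m X G k \<longleftrightarrow>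
     finite X \<and> X = (\<Union>i<m. G i) \<and> disjoint_family_on G {..<m} \<and> (\<forall>i<m. k i \<le> card (G i))"

definition fair_sets :: "nat \<Rightarrow> 'a::metric_space set \<Rightarrow> (nat \<Rightarrow> 'a set) \<Rightarrow> (nat \<Rightarrow> nat) \<Rightarrow> 'a set set" where
  "fair_sets m X G k = {S. S \<subseteq> X \<and> (\<forall>i<m. card (S \<inter> G i) = k i)}"

text \<open>For a \<open>fair_instance\<close> the family \<open>fair_sets\<close> is finite and nonempty, so \<open>Max\<close> is
  well defined.\<close>

definition opt_diversity :: "nat \<Rightarrow> 'a::metric_space set \<Rightarrow> (nat \<Rightarrow> 'a set) \<Rightarrow> (nat \<Rightarrow> nat) \<Rightarrow> ereal" where
  "opt_diversity m X G k = Max (diversity ` fair_sets m X G k)"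


section \<open>A real RAM\<close>

text \<open>Algorithms are programs of a structured imperative language over a real RAM with uniform cost.
  Memory consists of arrays of natural numbers (usable as addresses) and arrays of real numbers;
  a scalar variable is cell 0 of an array. A program mentions only finitely many array names.

  To keep unit costs realistic, natural numbers only support addition and truncated subtraction,
  the only real constants are integers, and reals cannot be converted to natural numbers (there is
  no rounding), so reals influence natural numbers only through comparisons. Real division is
  total, with \<open>x / 0 = 0\<close>.\<close>

type_synonym name = string

record state =
  nmem :: "name \<Rightarrow> nat \<Rightarrow> nat"
  rmem :: "name \<Rightarrow> nat \<Rightarrow> real"

datatype nexp =
    NLit nat
  | NGet name nexp
  | NAdd nexp nexp
  | NSub nexp nexp

datatype rexp =
    RLit int
  | RGet name nexp
  | RAdd rexp rexp
  | RSub rexp rexp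
  | RMul rexp rexp
  | RDiv rexp rexp

datatype bexp =
    NLess nexp nexp
  | RLess rexp rexp
  | BNot bexp
  | BAnd bexp bexp

datatype com =
    Skip
  | NSet name nexp nexp
  | RSet name nexp rexp
  | Seq com com
  | Cond bexp com com
  | While bexp com

primrec nval :: "nexp \<Rightarrow> state \<Rightarrow> nat" where
  "nval (NLit n) s = n"
| "nval (NGet a e) s = nmem s a (nval e s)"
| "nval (NAdd e f) s = nval e s + nval f s"
| "nval (NSub e f) s = nval e s - nval f s"

primrec rval :: "rexp \<Rightarrow> state \<Rightarrow> real" where
  "rval (RLit z) s = of_int z"
| "rval (RGet a e) s = rmem s a (nval e s)"
| "rval (RAdd e f) s = rval e s + rval f s"
| "rval (RSub e f) s = rval e s - rval f s"
| "rval (RMul e f) s = rval e s * rval f s"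
| "rval (RDiv e f) s = rval e s / rval f s"

primrec bval :: "bexp \<Rightarrow> state \<Rightarrow> bool" where
  "bval (NLess e f) s \<longleftrightarrow> nval e s < nval f s"
| "bval (RLess e f) s \<longleftrightarrow> rval e s < rval f s"
| "bval (BNot b) s \<longleftrightarrow> \<not> bval b s"
| "bval (BAnd b c) s \<longleftrightarrow> bval b s \<and> bval c s"

text \<open>Every node of an expression costs one unit, in addition to the unit that \<open>exec\<close> below charges
  for each assignment, branch and loop test.\<close>

primrec ncost :: "nexp \<Rightarrow> nat" where
  "ncost (NLit n) = 1"
| "ncost (NGet a e) = 1 + ncost e"
| "ncost (NAdd e f) = 1 + ncost e + ncost f"
| "ncost (NSub e f) = 1 + ncost e + ncost f"

primrec rcost :: "rexp \<Rightarrow> nat" where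
  "rcost (RLit z) = 1"
| "rcost (RGet a e) = 1 + ncost e"
| "rcost (RAdd e f) = 1 + rcost e + rcost f"
| "rcost (RSub e f) = 1 + rcost e + rcost f"
| "rcost (RMul e f) = 1 + rcost e + rcost f"
| "rcost (RDiv e f) = 1 + rcost e + rcost f"

primrec bcost :: "bexp \<Rightarrow> nat" where
  "bcost (NLess e f) = 1 + ncost e + ncost f"
| "bcost (RLess e f) = 1 + rcost e + rcost f"
| "bcost (BNot b) = 1 + bcost b"
| "bcost (BAnd b c) = 1 + bcost b + bcost c"

definition nset :: "name \<Rightarrow> nat \<Rightarrow> nat \<Rightarrow> state \<Rightarrow> state" where
  "nset a i v s = s\<lparr>nmem := (nmem s)(a := (nmem s a)(i := v))\<rparr>"

definition rset :: "name \<Rightarrow> nat \<Rightarrow> real \<Rightarrow> state \<Rightarrow> state" where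
  "rset a i v s = s\<lparr>rmem := (rmem s)(a := (rmem s a)(i := v))\<rparr>"

text \<open>\<open>exec c s t s'\<close>: started in state \<open>s\<close>, program \<open>c\<close> terminates in state \<open>s'\<close>
  after exactly \<open>t\<close> units of time.\<close>

inductive exec :: "com \<Rightarrow> state \<Rightarrow> nat \<Rightarrow> state \<Rightarrow> bool" where
  Skip: "exec Skip s 1 s"
| NSet: "exec (NSet a i e) s (1 + ncost i + ncost e) (nset a (nval i s) (nval e s) s)"
| RSet: "exec (RSet a i e) s (1 + ncost i + rcost e) (rset a (nval i s) (rval e s) s)"
| Seq: "exec c s t s' \<Longrightarrow> exec d s' t' s'' \<Longrightarrow> exec (Seq c d) s (t + t') s''"
| CondTrue: "bval b s \<Longrightarrow> exec c s t s' \<Longrightarrow> exec (Cond b c d) s (1 + bcost b + t) s'"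
| CondFalse: "\<not> bval b s \<Longrightarrow> exec d s t s' \<Longrightarrow> exec (Cond b c d) s (1 + bcost b + t) s'"
| WhileFalse: "\<not> bval b s \<Longrightarrow> exec (While b c) s (1 + bcost b) s"
| WhileTrue: "bval b s \<Longrightarrow> exec c s t s' \<Longrightarrow> exec (While b c) s' t' s'' \<Longrightarrow>
    exec (While b c) s (1 + bcost b + t + t') s''"

inductive_cases exec_elims:
  "exec Skip s t s'" "exec (NSet a i e) s t s'" "exec (RSet a i e) s t s'"
  "exec (Seq c d) s t s'" "exec (Cond b c d) s t s'"

inductive_cases exec_WhileE: "exec (While b c) s t s'"

lemma exec_deterministic:
  assumes "exec c s t s'" and "exec c s u s''"
  shows "t = u \<and> s' = s''"
  using assms
proof (induction arbitrary: u s'' rule: exec.induct)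
  case (Seq c s t s' d t' s2)
  from Seq.prems obtain v w r where "exec c s v r" "exec d r w s''" "u = v + w"
    by (rule exec_elims(4))
  with Seq.IH show ?case by metis
next
  case (CondTrue b s c t s' d)
  from CondTrue.prems CondTrue.hyps obtain v where "exec c s v s''" "u = 1 + bcost b + v"
    by (auto elim: exec_elims(5))
  with CondTrue.IH show ?case by metis
next
  case (CondFalse b s d t s' c)
  from CondFalse.prems CondFalse.hyps obtain v where "exec d s v s''" "u = 1 + bcost b + v"
    by (auto elim: exec_elims(5))
  with CondFalse.IH show ?case by metis
next
  case (WhileFalse b s c)
  from WhileFalse.prems WhileFalse.hyps show ?case by (cases rule: exec_WhileE) auto
next
  case (WhileTrue b s c t s' t' s2)
  from WhileTrue.prems WhileTrue.hyps(1) obtain v w r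
    where "exec c s v r" "exec (While b c) r w s''" "u = 1 + bcost b + v + w"
    by (cases rule: exec_WhileE) auto
  with WhileTrue.IH show ?case by metis
qed (auto elim: exec_elims(1-3))


section \<open>Input and output\<close>

text \<open>\<open>presents m X G xs gs\<close>: the list \<open>xs\<close> enumerates \<open>X\<close> in an arbitrary order (in particular,
  not necessarily sorted) and the \<open>j\<close>-th entry of \<open>gs\<close> is the index of the group of \<open>xs ! j\<close>.\<close>

definition presents :: "nat \<Rightarrow> 'a set \<Rightarrow> (nat \<Rightarrow> 'a set) \<Rightarrow> 'a list \<Rightarrow> nat list \<Rightarrow> bool" where
  "presents m X G xs gs \<longleftrightarrow>
     distinct xs \<and> set xs = X \<and> length gs = length xs \<and>
     (\<forall>j<length xs. gs ! j < m \<and> xs ! j \<in> G (gs ! j))"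

text \<open>All memory cells other than those holding the input are initially 0.\<close>

definition input_state :: "nat \<Rightarrow> (nat \<Rightarrow> nat) \<Rightarrow> real list \<Rightarrow> nat list \<Rightarrow> state" where
  "input_state m k xs gs =
     \<lparr> nmem = (\<lambda>_ _. 0)
        (''n'' := (\<lambda>_. 0)(0 := length xs),
         ''m'' := (\<lambda>_. 0)(0 := m),
         ''group'' := (\<lambda>j. if j < length gs then gs ! j else 0),
         ''k'' := (\<lambda>i. if i < m then k i else 0)),
       rmem = (\<lambda>_ _. 0)
        (''x'' := (\<lambda>j. if j < length xs then xs ! j else 0)) \<rparr>"

text \<open>The returned set is given by marking the positions of its elements in the input order.\<close>

definition output_set :: "real list \<Rightarrow> state \<Rightarrow> real set" where
  "output_set xs s = {xs ! j | j. j < length xs \<and> nmem s ''out'' j \<noteq> 0}"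

end

theory Submission
  imports Defs
begin

text \<open>Dynamic programming over vectors \<open>r\<close> of group sizes with \<open>r g \<le> k g\<close>: for a point \<open>j\<close>, let
  \<open>D(r, j)\<close> be the best separation of a set with \<open>r g\<close> points in each group \<open>g\<close> whose rightmost
  point is \<open>j\<close>. On a line the second rightmost point \<open>i\<close> is the nearest neighbour of \<open>j\<close>, so
  \<open>D(r, j)\<close> is the maximum over \<open>i\<close> of \<open>min (D(r - e, i)) (x j - x i)\<close>, with \<open>e\<close> the unit vector
  of the group of \<open>j\<close>. Candidates \<open>i\<close> to the right of \<open>j\<close> give negative values, so the input need
  not be sorted. The number \<open>B = 1 + (\<Sum>i. x i ^ 2)\<close> exceeds all distances and takes the place of
  the infinite diversity of singletons, and 0 marks pairs \<open>(r, j)\<close> without a set, in agreement with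
  the initial memory. An optimal set is read off from stored maximisers.

  The vector \<open>r\<close> is encoded in mixed radix as the sum of \<open>r g * w g\<close>, where \<open>w g\<close> is \<open>n\<close> times the
  product of \<open>k h + 1\<close> over the groups \<open>h\<close> seen before \<open>g\<close>; the factor \<open>n\<close> turns codes into row
  addresses, so that no multiplication of naturals is needed. Only groups that occur in the input
  get a weight, because the time bound does not allow a loop over all \<open>m\<close> groups. Since
  \<open>r - e\<close> has a smaller code than \<open>r\<close>, rows are filled in increasing order of address.\<close>

section \<open>Weakest preconditions with running time\<close>

text \<open>Since \<open>exec\<close> is deterministic, the existential expresses total correctness:
  the program halts, and its only outcome and running time satisfy \<open>Q\<close>.\<close>

definition wp :: "com \<Rightarrow> (nat \<Rightarrow> state \<Rightarrow> bool) \<Rightarrow> state \<Rightarrow> bool" where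
  "wp c Q s \<longleftrightarrow> (\<exists>t s'. exec c s t s' \<and> Q t s')"

lemma wp_mono:
  assumes "wp c Q s" and "\<And>t s'. Q t s' \<Longrightarrow> R t s'"
  shows "wp c R s"
  using assms unfolding wp_def by blast

lemma wp_Skip [simp]: "wp Skip Q s \<longleftrightarrow> Q 1 s"
  unfolding wp_def by (metis exec.Skip exec_deterministic)

lemma wp_NSet [simp]:
  "wp (NSet a i e) Q s \<longleftrightarrow> Q (1 + ncost i + ncost e) (nset a (nval i s) (nval e s) s)"
  unfolding wp_def by (metis exec.NSet exec_deterministic)

lemma wp_RSet [simp]:
  "wp (RSet a i e) Q s \<longleftrightarrow> Q (1 + ncost i + rcost e) (rset a (nval i s) (rval e s) s)"
  unfolding wp_def by (metis exec.RSet exec_deterministic)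

lemma wp_Seq [simp]: "wp (Seq c d) Q s \<longleftrightarrow> wp c (\<lambda>t. wp d (\<lambda>t'. Q (t + t'))) s"
  unfolding wp_def by (blast elim!: exec_elims(4) intro: exec.Seq)

lemma wp_Cond [simp]:
  "wp (Cond b c d) Q s \<longleftrightarrow>
    (if bval b s then wp c (\<lambda>t. Q (1 + bcost b + t)) s else wp d (\<lambda>t. Q (1 + bcost b + t)) s)"
proof (cases "bval b s")
  case True
  then show ?thesis
    unfolding wp_def by (auto elim!: exec_elims(5)) (metis exec.CondTrue plus_nat.add_Suc plus_1_eq_Suc)
next
  case False
  then show ?thesis
    unfolding wp_def by (auto elim!: exec_elims(5)) (metis exec.CondFalse plus_nat.add_Suc plus_1_eq_Suc)
qed

text \<open>The variant \<open>f\<close> drops in every round, so the body runs at most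
  \<open>f s\<close> times; the additional 1 in the first factor pays for the final failing
  test.\<close>

lemma wp_While:
  assumes "I s"
    and "\<And>s. I s \<Longrightarrow> bval b s \<Longrightarrow> wp c (\<lambda>t s'. t \<le> T \<and> I s' \<and> f s' < (f s :: nat)) s"
  shows "wp (While b c) (\<lambda>t s'. t \<le> (f s + 1) * (1 + bcost b + T) \<and> I s' \<and> \<not> bval b s') s"
  using assms(1)
proof (induction "f s" arbitrary: s rule: less_induct)
  case less
  show ?case
  proof (cases "bval b s")
    case False
    then have "exec (While b c) s (1 + bcost b) s" by (rule exec.WhileFalse)
    with False less.prems show ?thesis unfolding wp_def by fastforce
  next
    case True
    from assms(2)[OF less.prems True] obtain t s1
      where 1: "exec c s t s1" "t \<le> T" "I s1" "f s1 < f s" unfolding wp_def by blast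
    from less.hyps[OF 1(4,3)] obtain t' s2
      where 2: "exec (While b c) s1 t' s2" "t' \<le> (f s1 + 1) * (1 + bcost b + T)"
        "I s2" "\<not> bval b s2" unfolding wp_def by blast
    have "t' \<le> f s * (1 + bcost b + T)"
      using 2(2) mult_le_mono1[of "f s1 + 1" "f s" "1 + bcost b + T"] 1(4) by simp
    then have "1 + bcost b + t + t' \<le> (f s + 1) * (1 + bcost b + T)"
      using 1(2) by simp
    with exec.WhileTrue[OF True 1(1) 2(1)] 2(3,4) show ?thesis unfolding wp_def by blast
  qed
qed

section \<open>Counting loops\<close>

definition for_less :: "name \<Rightarrow> nexp \<Rightarrow> com \<Rightarrow> com" where
  "for_less v b c = Seq (NSet v (NLit 0) (NLit 0))
     (While (NLess (NGet v (NLit 0)) b)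
       (Seq c (NSet v (NLit 0) (NAdd (NGet v (NLit 0)) (NLit 1)))))"

lemma nmem_nset [simp]: "nmem (nset a i x s) b = (if b = a then (nmem s a)(i := x) else nmem s b)"
  and rmem_nset [simp]: "rmem (nset a i x s) = rmem s"
  and rmem_rset [simp]: "rmem (rset a i y s) b = (if b = a then (rmem s a)(i := y) else rmem s b)"
  and nmem_rset [simp]: "nmem (rset a i y s) = nmem s"
  by (auto simp: nset_def rset_def)

text \<open>The loop bound \<open>b\<close> is evaluated afresh at every test, hence
  \<open>bound\<close> asks the invariant to fix its value. Of the constant 13, 3 units initialise
  the counter; each round spends 4 on the test besides \<open>b\<close> and 6 on the
  increment.\<close>

lemma wp_for_less:
  assumes start: "I 0 (nset v 0 0 s)"
    and body: "\<And>i s. i < N \<Longrightarrow> I i s \<Longrightarrow> nmem s v 0 = i \<Longrightarrow>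
      wp c (\<lambda>t s'. t \<le> T \<and> nmem s' v 0 = i \<and> I (Suc i) (nset v 0 (Suc i) s')) s"
    and bound: "\<And>i s. I i s \<Longrightarrow> nval b s = N"
  shows "wp (for_less v b c) (\<lambda>t s'. t \<le> (N + 1) * (T + ncost b + 13) \<and> I N s') s"
proof -
  let ?J = "\<lambda>s. nmem s v 0 \<le> N \<and> I (nmem s v 0) s"
  let ?b = "NLess (NGet v (NLit 0)) b"
  let ?c = "Seq c (NSet v (NLit 0) (NAdd (NGet v (NLit 0)) (NLit 1)))"
  let ?f = "\<lambda>s. N - nmem s v 0"
  have "wp (While ?b ?c) (\<lambda>t s'. t \<le> (?f (nset v 0 0 s) + 1) * (1 + bcost ?b + (T + 6))
      \<and> ?J s' \<and> \<not> bval ?b s') (nset v 0 0 s)"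
  proof (rule wp_While)
    show "?J (nset v 0 0 s)" using start by simp
  next
    fix s assume J: "?J s" and "bval ?b s"
    then have lt: "nmem s v 0 < N" using bound by auto
    from body[OF lt conjunct2[OF J] refl]
    show "wp ?c (\<lambda>t s'. t \<le> T + 6 \<and> ?J s' \<and> ?f s' < ?f s) s"
      unfolding wp_Seq by (rule wp_mono) (use lt in auto)
  qed
  then have "wp (While ?b ?c) (\<lambda>t s'. 3 + t \<le> (N + 1) * (T + ncost b + 13) \<and> I N s')
      (nset v 0 0 s)"
  proof (rule wp_mono)
    fix t s'
    assume *: "t \<le> (?f (nset v 0 0 s) + 1) * (1 + bcost ?b + (T + 6)) \<and> ?J s' \<and> \<not> bval ?b s'"
    then have "nmem s' v 0 = N" using bound[of "nmem s' v 0" s'] by auto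
    moreover have "3 + t \<le> (N + 1) * (T + ncost b + 13)"
      using * by (auto simp: algebra_simps)
    ultimately show "3 + t \<le> (N + 1) * (T + ncost b + 13) \<and> I N s'" using * by auto
  qed
  then show ?thesis unfolding for_less_def by simp
qed

section \<open>Mixed radix weights and the recurrence\<close>

text \<open>Invariant of the mixed radix system once the groups in \<open>A\<close> have their
  weights. \<open>W\<close> is the weight for the next group and lies one row above the largest
  code. Reducing a code modulo \<open>p g\<close> drops the digits above that of \<open>g\<close>,
  so comparing the residue with \<open>w g\<close> tests whether the digit of \<open>g\<close> is
  positive.\<close>

definition weights :: "nat \<Rightarrow> (nat \<Rightarrow> nat) \<Rightarrow> nat set \<Rightarrow> (nat \<Rightarrow> nat) \<Rightarrow> (nat \<Rightarrow> nat) \<Rightarrow> nat \<Rightarrow> bool" where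
  "weights n k A w p W \<longleftrightarrow> finite A \<and>
     (\<forall>g\<in>A. n dvd w g \<and> 0 < w g \<and> p g = w g * (k g + 1) \<and> p g dvd W) \<and>
     W = n * (\<Prod>g\<in>A. k g + 1) \<and> (\<Sum>g\<in>A. k g * w g) + n = W \<and>
     (\<forall>r. (\<forall>g\<in>A. r g \<le> k g) \<longrightarrow>
       (\<forall>g\<in>A. 0 < r g \<longleftrightarrow> w g \<le> (\<Sum>h\<in>A. r h * w h) mod p g))"

lemma weights_empty: "weights n k {} w p n"
  by (simp add: weights_def)

text \<open>The new group becomes the most significant digit. Its own test compares the whole code
  with \<open>W\<close>, because the older digits contribute less than \<open>W\<close>; the older
  tests survive, because \<open>p h\<close> divides the new summand \<open>r g * W\<close>.\<close>

lemma weights_insert: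
  assumes "weights n k A w p W" and "g \<notin> A" and "0 < n"
  shows "weights n k (insert g A) (w(g := W)) (p(g := W * (k g + 1))) (W * (k g + 1))"
proof -
  let ?w = "w(g := W)" and ?p = "p(g := W * (k g + 1))"
  have fin: "finite A" and A: "\<And>h. h \<in> A \<Longrightarrow> n dvd w h \<and> 0 < w h \<and> p h = w h * (k h + 1) \<and> p h dvd W"
    and W: "W = n * (\<Prod>h\<in>A. k h + 1)" and kA: "(\<Sum>h\<in>A. k h * w h) + n = W"
    and dig: "\<And>r h. (\<And>h. h \<in> A \<Longrightarrow> r h \<le> k h) \<Longrightarrow> h \<in> A \<Longrightarrow>
        0 < r h \<longleftrightarrow> w h \<le> (\<Sum>h\<in>A. r h * w h) mod p h"
    using assms(1) unfolding weights_def by blast+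
  have pos: "0 < W" using kA \<open>0 < n\<close> by simp
  have sum_insert: "(\<Sum>h\<in>insert g A. r h * ?w h) = r g * W + (\<Sum>h\<in>A. r h * w h)" for r :: "nat \<Rightarrow> nat"
  proof -
    have "(\<Sum>h\<in>A. r h * ?w h) = (\<Sum>h\<in>A. r h * w h)"
      using \<open>g \<notin> A\<close> by (intro sum.cong) auto
    then show ?thesis using fin \<open>g \<notin> A\<close> by simp
  qed
  have digits: "0 < r h \<longleftrightarrow> ?w h \<le> (\<Sum>h\<in>insert g A. r h * ?w h) mod ?p h"
    if r: "\<And>h. h \<in> insert g A \<Longrightarrow> r h \<le> k h" and h: "h \<in> insert g A" for r h
  proof (cases "h = g")
    case True
    have "(\<Sum>h\<in>A. r h * w h) \<le> (\<Sum>h\<in>A. k h * w h)"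
      using r by (intro sum_mono mult_right_mono) auto
    then have low: "(\<Sum>h\<in>A. r h * w h) < W" using kA \<open>0 < n\<close> by linarith
    have "r g * W \<le> k g * W" using r by (intro mult_right_mono) auto
    moreover have "W * (k g + 1) = k g * W + W" by (simp add: algebra_simps)
    ultimately have "r g * W + (\<Sum>h\<in>A. r h * w h) < W * (k g + 1)" using low by linarith
    then have "(r g * W + (\<Sum>h\<in>A. r h * w h)) mod (W * (k g + 1)) = r g * W + (\<Sum>h\<in>A. r h * w h)"
      by (rule mod_less)
    moreover have "0 < r g \<longleftrightarrow> W \<le> r g * W + (\<Sum>h\<in>A. r h * w h)"
      using low by (cases "r g") auto
    ultimately show ?thesis unfolding sum_insert using True by simp
  next
    case False
    with h have hA: "h \<in> A" by simp
    with A have "p h dvd W" by blast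
    then have "p h dvd r g * W" by (rule dvd_mult)
    then have "(r g * W + (\<Sum>h\<in>A. r h * w h)) mod p h = (\<Sum>h\<in>A. r h * w h) mod p h"
      by (elim dvdE) (simp only: mod_mult_self4)
    then show ?thesis unfolding sum_insert using dig[of r h] r hA False by simp
  qed
  have "W * (k g + 1) = n * (\<Prod>h\<in>insert g A. k h + 1)"
    using W fin \<open>g \<notin> A\<close> by (simp add: algebra_simps)
  moreover have "(\<Sum>h\<in>insert g A. k h * ?w h) + n = W * (k g + 1)"
    unfolding sum_insert using kA by (simp add: algebra_simps)
  moreover have "\<forall>h\<in>insert g A. n dvd ?w h \<and> 0 < ?w h \<and> ?p h = ?w h * (k h + 1) \<and> ?p h dvd W * (k g + 1)"
  proof
    fix h assume "h \<in> insert g A"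
    then show "n dvd ?w h \<and> 0 < ?w h \<and> ?p h = ?w h * (k h + 1) \<and> ?p h dvd W * (k g + 1)"
    proof (cases "h = g")
      case True
      then show ?thesis using W pos by simp
    next
      case False
      with \<open>h \<in> insert g A\<close> have "h \<in> A" by simp
      from A[OF this] have "p h dvd W * (k g + 1)" by (intro dvd_mult2) blast
      with A[OF \<open>h \<in> A\<close>] False show ?thesis by simp
    qed
  qed
  ultimately show ?thesis unfolding weights_def using fin digits by blast
qed

section \<open>Separation of index sets by real thresholds\<close>

definition separated :: "real list \<Rightarrow> real \<Rightarrow> nat set \<Rightarrow> bool" where
  "separated xs t S \<longleftrightarrow> (\<forall>a\<in>S. \<forall>b\<in>S. a \<noteq> b \<longrightarrow> t \<le> \<bar>xs ! a - xs ! b\<bar>)"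

lemma ex_rightmost:
  assumes "finite S" and "S \<noteq> {}"
  shows "\<exists>i\<in>S. \<forall>i'\<in>S. xs ! i' \<le> (xs ! i :: real)"
proof -
  have "Max ((!) xs ` S) \<in> (!) xs ` S" using assms by (intro Max_in) auto
  then obtain i where i: "i \<in> S" and eq: "Max ((!) xs ` S) = xs ! i" by (rule imageE)
  have "\<forall>i'\<in>S. xs ! i' \<le> Max ((!) xs ` S)" using assms by simp
  with i show ?thesis unfolding eq by blast
qed

text \<open>Distinct points have a positive least gap. A positive threshold is what later tells
  entries of existing sets from the marker 0.\<close>

lemma ex_separated:
  assumes "finite S" and "S \<subseteq> {..<length xs}" and "distinct xs" and "0 < B"
  shows "\<exists>t>0. t \<le> B \<and> separated xs t S"
proof -
  let ?P = "{q \<in> S \<times> S. fst q \<noteq> snd q}"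
  let ?d = "\<lambda>q. \<bar>xs ! fst q - xs ! snd q\<bar>"
  \<comment> \<open>Inserting \<open>B\<close> caps the minimum and keeps it defined for sets with
    fewer than two points.\<close>
  let ?t = "Min (insert B (?d ` ?P))"
  have fin: "finite (insert B (?d ` ?P))" using assms(1) by auto
  have "xs ! fst q \<noteq> xs ! snd q" if "q \<in> ?P" for q
    using that assms(2,3) by (auto simp: nth_eq_iff_index_eq subset_iff)
  then have "0 < ?t" using fin \<open>0 < B\<close> by (subst Min_gr_iff) auto
  moreover have "?t \<le> B" using fin by (intro Min_le) auto
  moreover have "separated xs ?t S"
    unfolding separated_def
  proof (intro ballI impI)
    fix a b assume "a \<in> S" "b \<in> S" "a \<noteq> b"
    then have "(a, b) \<in> ?P" by simp
    then have "?d (a, b) \<in> insert B (?d ` ?P)" by blast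
    then have "?t \<le> ?d (a, b)" using fin by (rule Min_le[rotated])
    then show "?t \<le> \<bar>xs ! a - xs ! b\<bar>" by simp
  qed
  ultimately show ?thesis by blast
qed

text \<open>The residue of \<open>v\<close> is a multiple of \<open>n\<close> below
  \<open>q\<close>, hence at most \<open>q - n\<close>, so adding \<open>n\<close> either stays
  below \<open>q\<close> or hits \<open>q\<close> exactly. This justifies resetting a counter to 0
  in place of a division.\<close>

lemma mod_add_step:
  fixes n v q :: nat
  assumes "n dvd v" and "n dvd q" and "0 < q"
  shows "(v + n) mod q = (if v mod q + n < q then v mod q + n else 0)"
proof (cases "v mod q + n < q")
  case True
  then show ?thesis by (metis mod_add_left_eq mod_less)
next
  case False
  have "n dvd q - v mod q" using assms by (simp add: dvd_mod)
  moreover have "0 < q - v mod q" using assms(3) by simp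
  ultimately have "n \<le> q - v mod q" by (rule dvd_imp_le)
  with False \<open>0 < q - v mod q\<close> have "v mod q + n = q" by linarith
  then show ?thesis using False by (metis mod_add_left_eq mod_self)
qed

locale weighted_points =
  fixes n :: nat and k :: "nat \<Rightarrow> nat" and xs :: "real list" and gs :: "nat list"
    and w p :: "nat \<Rightarrow> nat" and W :: nat and B :: real
  assumes n_pos: "0 < n" and length_xs: "length xs = n" and length_gs: "length gs = n"
    and weights: "weights n k (set gs) w p W"
    and B_pos: "0 < B"
begin

section \<open>Arithmetic of codes\<close>

abbreviation "code r \<equiv> (\<Sum>g\<in>set gs. r g * w g)"

abbreviation "class S g \<equiv> {i \<in> S. gs ! i = g}"

lemma group_in [simp]: "j < n \<Longrightarrow> gs ! j \<in> set gs"
  using length_gs by simp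

lemma
  assumes "g \<in> set gs"
  shows n_dvd_w: "n dvd w g" and w_pos: "0 < w g" and p_eq: "p g = w g * (k g + 1)"
  using weights assms unfolding weights_def by blast+

lemma code_k: "code k + n = W" and W_eq: "W = n * (\<Prod>g\<in>set gs. k g + 1)"
  using weights unfolding weights_def by blast+

lemma n_le_w: "g \<in> set gs \<Longrightarrow> n \<le> w g"
  using n_dvd_w w_pos by (simp add: dvd_imp_le)

lemma n_dvd_p: "g \<in> set gs \<Longrightarrow> n dvd p g"
  using n_dvd_w p_eq by auto

lemma digit_pos:
  assumes "\<forall>g\<in>set gs. r g \<le> k g" and "g \<in> set gs"
  shows "0 < r g \<longleftrightarrow> w g \<le> code r mod p g"
  using weights assms unfolding weights_def by blast

lemma n_dvd_code: "n dvd code r"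
  using n_dvd_w by (intro dvd_sum) auto

lemma code_le: "(\<forall>g\<in>set gs. r g \<le> k g) \<Longrightarrow> code r \<le> code k"
  by (intro sum_mono mult_right_mono) auto

lemma code_eq_0: "code r = 0 \<longleftrightarrow> (\<forall>g\<in>set gs. r g = 0)"
  using w_pos by fastforce

lemma code_decrease:
  assumes "g \<in> set gs" and "0 < r g"
  shows "code (r(g := r g - 1)) + w g = code r"
proof -
  have "code r = r g * w g + (\<Sum>h\<in>set gs - {g}. r h * w h)"
    using assms(1) by (intro sum.remove) auto
  moreover have "code (r(g := r g - 1)) = (r g - 1) * w g + (\<Sum>h\<in>set gs - {g}. r h * w h)"
    using assms(1) by (subst sum.remove[of _ g]) auto
  moreover have "(r g - 1) * w g + w g = r g * w g"
    using assms(2) by (cases "r g") auto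
  ultimately show ?thesis by simp
qed

text \<open>The entry \<open>v + j\<close> with \<open>v = code r\<close> is the largest separation, capped at \<open>B\<close>, of a set with
  \<open>r g\<close> points in each group \<open>g\<close> whose rightmost point is \<open>j\<close>, and 0 if there is none. By
  \<open>digit_pos\<close> the first condition says that \<open>r\<close> has a point of the group of \<open>j\<close>.\<close>

definition entry :: "nat \<Rightarrow> nat \<Rightarrow> (nat \<Rightarrow> real) \<Rightarrow> (nat \<Rightarrow> nat) \<Rightarrow> bool" where
  "entry v j D par \<longleftrightarrow> (let g = gs ! j in
     (0 < D (v + j) \<longrightarrow> w g \<le> v mod p g \<and>
       (v = w g \<or> w g < v \<and> par (v + j) < n \<and> D (v + j) \<le> D (v - w g + par (v + j)) \<and>
         D (v + j) \<le> xs ! j - xs ! par (v + j))) \<and>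
     (w g \<le> v mod p g \<longrightarrow>
       (v = w g \<longrightarrow> D (v + j) = B) \<and>
       (w g < v \<longrightarrow> (\<forall>i<n. min (D (v - w g + i)) (xs ! j - xs ! i) \<le> D (v + j)))))"

section \<open>The table and its order of evaluation\<close>

definition table :: "nat \<Rightarrow> (nat \<Rightarrow> real) \<Rightarrow> (nat \<Rightarrow> nat) \<Rightarrow> bool" where
  "table a D par \<longleftrightarrow> (\<forall>v j. n dvd v \<longrightarrow> j < n \<longrightarrow> v + j < a \<longrightarrow> entry v j D par)"

text \<open>As a weight is at least \<open>n\<close>, the recurrence reads only rows strictly below
  the current one; this justifies filling by increasing address.\<close>

lemma address_lt:
  assumes "j < n" and "i < n" and "w (gs ! j) < v"
  shows "v - w (gs ! j) + i < v"
  using n_le_w[of "gs ! j"] assms by simp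

text \<open>Frame property: predecessors have smaller addresses, so writes above
  \<open>v + j\<close> cannot invalidate the entry.\<close>

lemma entry_cong:
  assumes "\<And>a. a \<le> v + j \<Longrightarrow> D a = D' a \<and> par a = par' a" and "j < n"
  shows "entry v j D par \<longleftrightarrow> entry v j D' par'"
proof -
  have "D (v - w (gs ! j) + i) = D' (v - w (gs ! j) + i)" if "i < n" "w (gs ! j) < v" for i
    using address_lt[OF assms(2) that] assms(1) by auto
  then show ?thesis using assms(1)[of "v + j"] unfolding entry_def Let_def by auto
qed

lemma table_cong:
  assumes "\<And>b. b < a \<Longrightarrow> D b = D' b \<and> par b = par' b"
  shows "table a D par \<longleftrightarrow> table a D' par'"
proof -
  have "entry v j D par \<longleftrightarrow> entry v j D' par'" if "j < n" "v + j < a" for v j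
    using that assms by (intro entry_cong) auto
  then show ?thesis unfolding table_def by auto
qed

text \<open>An address determines its row and column, \<open>v + j\<close> being a division by
  \<open>n\<close> with remainder \<open>j\<close>, so one further address adds exactly one
  entry.\<close>

lemma table_Suc:
  assumes "table (v + j) D par" and "n dvd v" and "j < n" and "entry v j D par"
  shows "table (v + Suc j) D par"
  unfolding table_def
proof (intro allI impI)
  fix v' j' assume *: "n dvd v'" "j' < n" "v' + j' < v + Suc j"
  show "entry v' j' D par"
  proof (cases "v' + j' < v + j")
    case True
    with * assms(1) show ?thesis unfolding table_def by blast
  next
    case False
    with * have eq: "v' + j' = v + j" by simp
    then have "(v' + j') mod n = (v + j) mod n" by simp
    then have "j' = j" using * assms(2,3) by (auto elim!: dvdE)
    with eq assms(4) show ?thesis by simp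
  qed
qed

section \<open>Completeness of the table\<close>

lemma class_remove:
  assumes "finite S" and "j \<in> S"
  shows "card (class (S - {j}) g) = (if g = gs ! j then card (class S g) - 1 else card (class S g))"
proof (cases "g = gs ! j")
  case True
  then have "class (S - {j}) g = class S g - {j}" by auto
  with True assms show ?thesis by (simp add: card_Diff_singleton)
next
  case False
  then have "class (S - {j}) g = class S g" by auto
  with False show ?thesis by simp
qed

text \<open>Induction on the size of the set: drop the rightmost point \<open>j\<close> and apply
  the hypothesis to the rest, whose rightmost point \<open>i\<close> is among the candidates
  compared at \<open>j\<close>. The assumption \<open>t \<le> B\<close> settles singletons.\<close>

lemma table_complete:
  assumes "table W D par" and "S \<subseteq> {..<n}" and "j \<in> S" and "\<forall>i\<in>S. xs ! i \<le> xs ! j"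
    and "\<forall>g\<in>set gs. card (class S g) = r g" and "\<forall>g\<in>set gs. r g \<le> k g"
    and "t \<le> B" and "separated xs t S"
  shows "t \<le> D (code r + j)"
  using assms(2-6,8)
proof (induction "card S" arbitrary: S r j rule: less_induct)
  case less
  let ?g = "gs ! j" and ?S = "S - {j}"
  let ?r = "r(?g := r ?g - 1)"
  have fin: "finite S" using less.prems(1) finite_subset by blast
  have j: "j < n" using less.prems(1,2) by auto
  have "j \<in> class S ?g" using less.prems(2) by simp
  then have "0 < card (class S ?g)" using fin card_gt_0_iff by fastforce
  then have pos: "0 < r ?g" using less.prems(4) j by simp
  have dec: "code ?r + w ?g = code r" using pos j by (intro code_decrease) auto
  have dig: "w ?g \<le> code r mod p ?g" using digit_pos[OF less.prems(5), of ?g] pos j by simp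
  have "code r + j < W" using code_le[OF less.prems(5)] code_k j by linarith
  then have entry: "entry (code r) j D par"
    using assms(1) n_dvd_code j unfolding table_def by blast
  have r': "\<forall>g\<in>set gs. card (class ?S g) = ?r g"
    using less.prems(4) class_remove[OF fin less.prems(2)] by simp
  show ?case
  proof (cases "?S = {}")
    case True
    then have "\<forall>g\<in>set gs. ?r g = 0" using r' by (simp add: True)
    \<comment> \<open>No other digit is left, so the code is the bare weight and the entry holds the
      cap \<open>B\<close>.\<close>
    then have "code r = w ?g" using dec code_eq_0[of ?r] by simp
    then show ?thesis using entry dig \<open>t \<le> B\<close> unfolding entry_def Let_def by simp
  next
    case False
    obtain i where i: "i \<in> ?S" and i_max: "\<forall>i'\<in>?S. xs ! i' \<le> xs ! i"
      using ex_rightmost[of ?S xs] fin False by blast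
    have in_: "i < n" using i less.prems(1) by auto
    have "i \<in> class ?S (gs ! i)" using i by simp
    then have "0 < card (class ?S (gs ! i))" using fin card_gt_0_iff by fastforce
    then have "?r (gs ! i) \<noteq> 0" using r' in_ by simp
    \<comment> \<open>The remaining point \<open>i\<close> leaves a nonzero digit, which puts the
      entry at \<open>j\<close> into the recursive case.\<close>
    then have "0 < code ?r" using code_eq_0[of ?r] in_ group_in by fastforce
    with dec have lt: "w ?g < code r" and eq: "code r - w ?g = code ?r" by simp_all
    have "t \<le> D (code ?r + i)"
    proof (rule less.hyps)
      show "card ?S < card S" using fin less.prems(2) by (rule card_Diff1_less)
      show "separated xs t ?S" using less.prems(6) unfolding separated_def by blast
      show "\<forall>g\<in>set gs. ?r g \<le> k g" using less.prems(5) by (auto intro: le_trans[OF diff_le_self])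
      show "?S \<subseteq> {..<n}" using less.prems(1) by blast
    qed (fact i i_max r')+
    moreover have "t \<le> xs ! j - xs ! i"
    proof -
      have "t \<le> \<bar>xs ! j - xs ! i\<bar>" using less.prems(2,6) i unfolding separated_def by auto
      moreover have "xs ! i \<le> xs ! j" using less.prems(3) i by auto
      ultimately show ?thesis by simp
    qed
    moreover have "min (D (code ?r + i)) (xs ! j - xs ! i) \<le> D (code r + j)"
      using entry dig lt in_ unfolding entry_def Let_def eq by blast
    ultimately show ?thesis by linarith
  qed
qed

text \<open>The invariant of the traceback: \<open>S\<close> are the points chosen so far, \<open>i\<close> is the next one, and
  \<open>v\<close> encodes the numbers of points that are still missing.\<close>

definition trace :: "(nat \<Rightarrow> real) \<Rightarrow> real \<Rightarrow> nat \<Rightarrow> nat \<Rightarrow> nat set \<Rightarrow> bool" where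
  "trace D d v i S \<longleftrightarrow> S \<subseteq> {..<n} \<and> separated xs d S \<and>
     (\<exists>r. v = code r \<and> (\<forall>g\<in>set gs. card (class S g) + r g = k g)) \<and>
     (0 < v \<longrightarrow> i < n \<and> d \<le> D (v + i) \<and> (\<forall>a\<in>S. xs ! i + d \<le> xs ! a))"

section \<open>Soundness of the traceback\<close>

lemma trace_start:
  assumes "i < n" and "d \<le> D (code k + i)"
  shows "trace D d (code k) i {}"
  unfolding trace_def separated_def using assms by auto

text \<open>Positivity of \<open>d\<close> makes the entry at \<open>v + i\<close> positive, so
  either \<open>i\<close> is the last missing point or the stored maximiser is valid and its entry
  is again at least \<open>d\<close>. Weights are positive, hence the code drops.\<close>

lemma trace_step:
  assumes "trace D d v i S" and "table W D par" and "0 < v" and "0 < d"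
  shows "trace D d (v - w (gs ! i)) (par (v + i)) (insert i S)"
    and "i < n" and "v - w (gs ! i) < v"
proof -
  let ?g = "gs ! i"
  obtain r where S: "S \<subseteq> {..<n}" "separated xs d S" and v: "v = code r"
    and r: "\<And>g. g \<in> set gs \<Longrightarrow> card (class S g) + r g = k g"
    and i: "i < n" "d \<le> D (v + i)" "\<And>a. a \<in> S \<Longrightarrow> xs ! i + d \<le> xs ! a"
    using assms(1,3) unfolding trace_def by blast
  show "i < n" by fact
  then show "v - w ?g < v" using w_pos[of ?g] \<open>0 < v\<close> by simp
  have fin: "finite S" using S(1) finite_subset by blast
  have rk: "\<forall>g\<in>set gs. r g \<le> k g" using r by (metis le_add2)
  have "v + i < W" using code_le[OF rk] code_k i(1) v by linarith
  then have entry: "entry v i D par"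
    using assms(2) n_dvd_code i(1) v unfolding table_def by blast
  have "0 < D (v + i)" using i(2) \<open>0 < d\<close> by simp
  then have dig: "w ?g \<le> v mod p ?g"
    and prev: "v = w ?g \<or> w ?g < v \<and> par (v + i) < n \<and> D (v + i) \<le> D (v - w ?g + par (v + i)) \<and>
         D (v + i) \<le> xs ! i - xs ! par (v + i)"
    using entry unfolding entry_def Let_def by blast+
  have pos: "0 < r ?g" using digit_pos[OF rk, of ?g] dig i(1) v by simp
  let ?r = "r(?g := r ?g - 1)"
  have code: "v - w ?g = code ?r" using code_decrease[of ?g r] pos i(1) v by simp
  \<comment> \<open>A point already chosen would have to lie at least \<open>d\<close> to the right
    of itself.\<close>
  have notin: "i \<notin> S" using i(3)[of i] \<open>0 < d\<close> by auto
  have "class (insert i S) g = (if g = ?g then insert i (class S g) else class S g)" for g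
    by auto
  then have "card (class (insert i S) g) = (if g = ?g then Suc (card (class S g)) else card (class S g))" for g
    using fin notin by simp
  then have "\<forall>g\<in>set gs. card (class (insert i S) g) + ?r g = k g"
    using r pos by fastforce
  moreover have "separated xs d (insert i S)"
    using S(2) i(3) unfolding separated_def by fastforce
  \<comment> \<open>The next point lies at least \<open>d\<close> to the left of \<open>i\<close>,
    and \<open>i\<close> lies to the left of all earlier points, so the gap to the nearest neighbour
    suffices.\<close>
  moreover have "0 < v - w ?g \<longrightarrow> par (v + i) < n \<and> d \<le> D (v - w ?g + par (v + i)) \<and>
      (\<forall>a\<in>insert i S. xs ! par (v + i) + d \<le> xs ! a)"
    using prev i(2,3) \<open>0 < d\<close> by fastforce
  ultimately show "trace D d (v - w ?g) (par (v + i)) (insert i S)"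
    unfolding trace_def using S(1) i(1) code by auto
qed

lemma trace_end:
  assumes "trace D d 0 i S" and "g \<in> set gs"
  shows "card (class S g) = k g"
  using assms code_eq_0 unfolding trace_def by (metis add_0_right)

section \<open>Feasible sets and the final row\<close>

definition feasible :: "nat set \<Rightarrow> bool" where
  "feasible S \<longleftrightarrow> S \<subseteq> {..<n} \<and> (\<forall>g\<in>set gs. card (class S g) = k g)"

text \<open>The bound \<open>n < W\<close> makes \<open>code k\<close> nonzero, so a feasible set
  has a rightmost point and \<open>table_complete\<close> applies with \<open>k\<close> for
  \<open>r\<close>.\<close>

lemma feasible_le_best:
  assumes "table W D par" and "\<forall>j<n. D (code k + j) \<le> d" and "n < W"
    and "feasible S" and "t \<le> B" and "separated xs t S"
  shows "t \<le> d"
proof -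
  have S: "S \<subseteq> {..<n}" "finite S" and cards: "\<forall>g\<in>set gs. card (class S g) = k g"
    using assms(4) finite_subset unfolding feasible_def by blast+
  have "code k \<noteq> 0" using code_k \<open>n < W\<close> by linarith
  then have "S \<noteq> {}" using cards code_eq_0[of k] by auto
  with ex_rightmost[OF S(2)] obtain j where j: "j \<in> S" "\<forall>i\<in>S. xs ! i \<le> xs ! j" by blast
  have "t \<le> D (code k + j)"
    using table_complete[OF assms(1) S(1) j cards] assms(5,6) by simp
  also have "\<dots> \<le> d" using assms(2) j(1) S(1) by auto
  finally show ?thesis .
qed

text \<open>Together with \<open>ex_separated\<close> this makes the best entry of the final row
  positive, so that the traceback can start.\<close>

lemma ex_feasible:
  assumes "\<forall>g\<in>set gs. k g \<le> card (class {..<n} g)"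
  shows "\<exists>S. feasible S"
proof -
  have "\<forall>g\<in>set gs. \<exists>T. T \<subseteq> class {..<n} g \<and> card T = k g"
    using assms obtain_subset_with_card_n by metis
  then obtain T where T: "\<And>g. g \<in> set gs \<Longrightarrow> T g \<subseteq> class {..<n} g \<and> card (T g) = k g"
    by metis
  have "class (\<Union>g\<in>set gs. T g) g = T g" if "g \<in> set gs" for g
    using T that by blast
  then have "feasible (\<Union>g\<in>set gs. T g)" unfolding feasible_def using T by auto
  then show ?thesis by blast
qed

end

section \<open>The program\<close>

abbreviation nvar :: "name \<Rightarrow> nexp" where
  "nvar a \<equiv> NGet a (NLit 0)"

abbreviation assign :: "name \<Rightarrow> nexp \<Rightarrow> com" where
  "assign a \<equiv> NSet a (NLit 0)"

abbreviation group_attr :: "name \<Rightarrow> name \<Rightarrow> nexp" where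
  "group_attr a j \<equiv> NGet a (NGet ''group'' (nvar j))"

text \<open>Weight 0 marks a group not met before, since assigned weights are positive. The product
  \<open>W * (k g + 1)\<close> arises by adding the fresh weight, which is the old \<open>W\<close>,
  \<open>k g\<close> times.\<close>

definition weights_cell_com :: com where
  "weights_cell_com =
      Seq (RSet ''B'' (NLit 0) (RAdd (RGet ''B'' (NLit 0))
              (RMul (RGet ''x'' (nvar ''j'')) (RGet ''x'' (nvar ''j'')))))
        (Cond (NLess (NLit 0) (group_attr ''w'' ''j'')) Skip
          (Seq (NSet ''w'' (NGet ''group'' (nvar ''j'')) (nvar ''W''))
          (Seq (for_less ''i'' (group_attr ''k'' ''j'')
                 (assign ''W'' (NAdd (nvar ''W'') (group_attr ''w'' ''j''))))
            (NSet ''top'' (NGet ''group'' (nvar ''j'')) (nvar ''W'')))))"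

definition weights_com :: com where
  "weights_com = Seq (assign ''W'' (nvar ''n'')) (Seq (RSet ''B'' (NLit 0) (RLit 1))
    (for_less ''j'' (nvar ''n'') weights_cell_com))"

text \<open>The update is strict, so an entry keeps its initial 0 unless some candidate is positive,
  and \<open>par\<close> is set whenever the entry becomes positive.\<close>

definition relax_com :: com where
  "relax_com =
    (let prev = RGet ''D'' (NAdd (NSub (nvar ''v'') (group_attr ''w'' ''j'')) (nvar ''i''));
         here = NAdd (nvar ''v'') (nvar ''j'');
         y = RGet ''y'' (NLit 0) in
      Seq (RSet ''y'' (NLit 0) (RSub (RGet ''x'' (nvar ''j'')) (RGet ''x'' (nvar ''i''))))
     (Seq (Cond (RLess prev y) (RSet ''y'' (NLit 0) prev) Skip)
       (Cond (RLess (RGet ''D'' here) y) (Seq (RSet ''D'' here y) (NSet ''par'' here (nvar ''i''))) Skip)))"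

text \<open>If the digit of the group of \<open>j\<close> is 0, the cell keeps its 0. In the last
  branch the code equals the weight of that group, so \<open>j\<close> is the only point and the
  entry is \<open>B\<close>.\<close>

definition cell_com :: com where
  "cell_com = Cond (NLess (NGet ''c'' (nvar ''j'')) (group_attr ''w'' ''j'')) Skip
    (Cond (NLess (group_attr ''w'' ''j'') (nvar ''v''))
      (for_less ''i'' (nvar ''n'') relax_com)
      (RSet ''D'' (NAdd (nvar ''v'') (nvar ''j'')) (RGet ''B'' (NLit 0))))"

text \<open>The digit test needs \<open>v\<close> modulo \<open>top g\<close>. As the machine cannot divide, this residue is kept
  for every point in \<open>c\<close> and updated when \<open>v\<close> grows by \<open>n\<close>.\<close>

definition count_com :: com where
  "count_com = Seq (NSet ''c'' (nvar ''j'') (NAdd (NGet ''c'' (nvar ''j'')) (nvar ''n'')))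
    (Cond (NLess (NGet ''c'' (nvar ''j'')) (group_attr ''top'' ''j'')) Skip
      (NSet ''c'' (nvar ''j'') (NLit 0)))"

definition row_com :: com where
  "row_com = Seq (for_less ''j'' (nvar ''n'') (Seq cell_com count_com))
    (assign ''v'' (NAdd (nvar ''v'') (nvar ''n'')))"

definition fill_com :: com where
  "fill_com = While (NLess (nvar ''v'') (nvar ''W'')) row_com"

text \<open>\<open>W - n\<close> is \<open>code k\<close>, the address of the last row.\<close>

definition select_com :: com where
  "select_com = Seq (assign ''v'' (NSub (nvar ''W'') (nvar ''n''))) (Seq (assign ''i'' (NLit 0))
    (for_less ''j'' (nvar ''n'')
      (Cond (RLess (RGet ''D'' (NAdd (nvar ''v'') (nvar ''i''))) (RGet ''D'' (NAdd (nvar ''v'') (nvar ''j''))))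
        (assign ''i'' (nvar ''j'')) Skip)))"

text \<open>\<open>u\<close> saves the predecessor, because the old \<open>i\<close> is still needed
  to look up the weight to subtract.\<close>

definition trace_com :: com where
  "trace_com = While (NLess (NLit 0) (nvar ''v''))
    (Seq (NSet ''out'' (nvar ''i'') (NLit 1))
    (Seq (assign ''u'' (NGet ''par'' (NAdd (nvar ''v'') (nvar ''i''))))
    (Seq (assign ''v'' (NSub (nvar ''v'') (group_attr ''w'' ''i'')))
      (assign ''i'' (nvar ''u'')))))"

text \<open>\<open>W = n\<close> means that no occurring group asks for a point; the initially empty
  output is then the answer.\<close>

definition fair_com :: com where
  "fair_com = Seq weights_com (Seq fill_com
    (Cond (NLess (nvar ''n'') (nvar ''W'')) (Seq select_com trace_com) Skip))"

context weighted_points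
begin

section \<open>Filling the table\<close>

definition prepared :: "state \<Rightarrow> bool" where
  "prepared s \<longleftrightarrow> nmem s ''n'' 0 = n \<and> nmem s ''W'' 0 = W \<and> nmem s ''w'' = w \<and> nmem s ''top'' = p \<and>
     rmem s ''B'' 0 = B \<and> (\<forall>j<n. nmem s ''group'' j = gs ! j \<and> rmem s ''x'' j = xs ! j)"

text \<open>Running maximum over the candidates below \<open>m\<close>. It starts at 0, so
  candidates to the right of \<open>j\<close>, having negative values, never win.\<close>

definition partial_entry :: "nat \<Rightarrow> nat \<Rightarrow> nat \<Rightarrow> (nat \<Rightarrow> real) \<Rightarrow> (nat \<Rightarrow> nat) \<Rightarrow> bool" where
  "partial_entry v j m D par \<longleftrightarrow> (let g = gs ! j in
     (\<forall>i<m. min (D (v - w g + i)) (xs ! j - xs ! i) \<le> D (v + j)) \<and>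
     (0 < D (v + j) \<longrightarrow> par (v + j) < n \<and> D (v + j) \<le> D (v - w g + par (v + j)) \<and>
         D (v + j) \<le> xs ! j - xs ! par (v + j)) \<and> 0 \<le> D (v + j))"

text \<open>The zeros from address \<open>a\<close> on belong to the invariant because the running
  maximum starts from the stored 0 and cells with a zero digit are never written.\<close>

definition filled :: "nat \<Rightarrow> (nat \<Rightarrow> real) \<Rightarrow> (nat \<Rightarrow> nat) \<Rightarrow> bool" where
  "filled a D par \<longleftrightarrow> table a D par \<and> (\<forall>b\<ge>a. D b = 0)"

lemma partial_entry_step:
  assumes "partial_entry v j i D par" and "i < n" and "j < n" and "w (gs ! j) < v"
    and y: "y = min (D (v - w (gs ! j) + i)) (xs ! j - xs ! i)"
  shows "D (v + j) < y \<Longrightarrow> partial_entry v j (Suc i) (D(v + j := y)) (par(v + j := i))"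
    and "\<not> D (v + j) < y \<Longrightarrow> partial_entry v j (Suc i) D par"
proof -
  \<comment> \<open>All predecessor cells lie in lower rows, so the write to \<open>v + j\<close>
    leaves them intact.\<close>
  have ne: "v - w (gs ! j) + i' \<noteq> v + j" if "i' < n" for i'
    using address_lt[OF \<open>j < n\<close> that assms(4)] by simp
  show "partial_entry v j (Suc i) (D(v + j := y)) (par(v + j := i))" if "D (v + j) < y"
    using assms(1) that ne \<open>i < n\<close> unfolding partial_entry_def Let_def y
    by (auto simp: less_Suc_eq intro: order.trans[OF _ less_imp_le])
  show "partial_entry v j (Suc i) D par" if "\<not> D (v + j) < y"
    using assms(1) that unfolding partial_entry_def Let_def y by (auto simp: less_Suc_eq)
qed

lemma wp_relax:
  fixes v j :: nat
  assumes vj: "j < n" "w (gs ! j) < v"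
    and s: "prepared s" "nmem s ''v'' 0 = v" "nmem s ''j'' 0 = j" "nmem s ''c'' = c" "nmem s ''out'' = out"
      "table (v + j) (rmem s ''D'') (nmem s ''par'')" "\<forall>a>v + j. rmem s ''D'' a = 0"
      "rmem s ''D'' (v + j) = 0"
  shows "wp (for_less ''i'' (nvar ''n'') relax_com)
    (\<lambda>t s'. t \<le> (n + 1) * 90 \<and> prepared s' \<and> nmem s' ''v'' 0 = v \<and> nmem s' ''j'' 0 = j \<and>
       nmem s' ''c'' = c \<and> nmem s' ''out'' = out \<and>
       table (v + j) (rmem s' ''D'') (nmem s' ''par'') \<and> (\<forall>a>v + j. rmem s' ''D'' a = 0) \<and>
       partial_entry v j n (rmem s' ''D'') (nmem s' ''par'')) s"
proof -
  define I where "I = (\<lambda>i s'. prepared s' \<and> nmem s' ''v'' 0 = v \<and> nmem s' ''j'' 0 = j \<and>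
       nmem s' ''c'' = c \<and> nmem s' ''out'' = out \<and>
       table (v + j) (rmem s' ''D'') (nmem s' ''par'') \<and> (\<forall>a>v + j. rmem s' ''D'' a = 0) \<and>
       partial_entry v j i (rmem s' ''D'') (nmem s' ''par''))"
  have "wp (for_less ''i'' (nvar ''n'') relax_com)
    (\<lambda>t s'. t \<le> (n + 1) * (70 + ncost (nvar ''n'') + 13) \<and> I n s') s"
  proof (rule wp_for_less)
    show "I 0 (nset ''i'' 0 0 s)"
      using s unfolding I_def prepared_def partial_entry_def by simp
  next
    fix i s
    assume i: "i < n" and I: "I i s" and si: "nmem s ''i'' 0 = i"
    have prev: "min (rmem s ''D'' (v - w (gs ! j) + i)) (xs ! j - xs ! i) =
        (if rmem s ''D'' (v - w (gs ! j) + i) < xs ! j - xs ! i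
         then rmem s ''D'' (v - w (gs ! j) + i) else xs ! j - xs ! i)" by auto
    have table: "table (v + j) ((rmem s ''D'')(v + j := y)) ((nmem s ''par'')(v + j := i))" for y
      using I table_cong[of "v + j" "(rmem s ''D'')(v + j := y)" "rmem s ''D''" _ "nmem s ''par''"]
      unfolding I_def by auto
    have "partial_entry v j i (rmem s ''D'') (nmem s ''par'')" using I unfolding I_def by blast
    note step = partial_entry_step[OF this i vj refl, unfolded prev]
    show "wp relax_com (\<lambda>t s'. t \<le> 70 \<and> nmem s' ''i'' 0 = i \<and> I (Suc i) (nset ''i'' 0 (Suc i) s')) s"
    proof -
      note I' = I[unfolded I_def prepared_def]
      have s: "nmem s ''group'' j = gs ! j" "nmem s ''v'' 0 = v" "nmem s ''j'' 0 = j"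
        "nmem s ''w'' = w" "rmem s ''x'' j = xs ! j" "rmem s ''x'' i = xs ! i"
        using I' i vj by auto
      show ?thesis
        using I' step table
        by (cases "rmem s ''D'' (v - w (gs ! j) + i) < xs ! j - xs ! i")
          (simp_all add: relax_com_def Let_def s si I_def prepared_def)
    qed
  next
    show "nval (nvar ''n'') s = n" if "I i s" for i s
      using that unfolding I_def prepared_def by simp
  qed
  then show ?thesis by (rule wp_mono) (simp add: I_def)
qed

lemma filled_Suc:
  assumes "table (v + j) D par" and "n dvd v" and "j < n" and "entry v j D par"
    and "\<forall>a>v + j. D a = 0"
  shows "filled (v + Suc j) D par"
  using table_Suc[OF assms(1-4)] assms(5) unfolding filled_def by simp

lemma wp_cell:
  fixes v j :: nat
  assumes j: "j < n" and v: "n dvd v"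
    and s: "prepared s" "nmem s ''v'' 0 = v" "nmem s ''j'' 0 = j" "nmem s ''c'' j = v mod p (gs ! j)"
      "filled (v + j) (rmem s ''D'') (nmem s ''par'')"
  shows "wp cell_com
    (\<lambda>t s'. t \<le> (n + 1) * 90 + 40 \<and> prepared s' \<and> nmem s' ''v'' 0 = v \<and> nmem s' ''j'' 0 = j \<and>
       nmem s' ''c'' = nmem s ''c'' \<and> nmem s' ''out'' = nmem s ''out'' \<and>
       filled (v + Suc j) (rmem s' ''D'') (nmem s' ''par'')) s"
proof -
  let ?D = "rmem s ''D''" and ?par = "nmem s ''par''"
  have table: "table (v + j) ?D ?par" and fresh: "\<forall>a\<ge>v + j. ?D a = 0"
    using s(5) unfolding filled_def by blast+
  have cells: "nmem s ''group'' j = gs ! j" "nmem s ''w'' = w" "rmem s ''B'' 0 = B"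
    using s(1) j unfolding prepared_def by auto
  \<comment> \<open>In the last case the weight is at least \<open>v\<close> and at most
    \<open>v mod p (gs ! j) \<le> v\<close>, which forces equality.\<close>
  consider "v mod p (gs ! j) < w (gs ! j)"
    | "w (gs ! j) \<le> v mod p (gs ! j)" "w (gs ! j) < v"
    | "w (gs ! j) \<le> v mod p (gs ! j)" "v = w (gs ! j)"
    by (metis leI le_antisym mod_less_eq_dividend order.trans)
  then show ?thesis
  proof cases
    case 1
    then have "entry v j ?D ?par" using fresh unfolding entry_def Let_def by simp
    then have "filled (v + Suc j) ?D ?par"
      using filled_Suc[OF table v j] fresh by simp
    then show ?thesis using 1 s cells by (simp add: cell_com_def)
  next
    case 2
    \<comment> \<open>The added 20 units cover the two tests passed before the loop.\<close>
    have "wp (for_less ''i'' (nvar ''n'') relax_com)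
      (\<lambda>t s'. Suc (Suc (t + 18)) \<le> (n + 1) * 90 + 40 \<and> prepared s' \<and> nmem s' ''v'' 0 = v \<and> nmem s' ''j'' 0 = j \<and>
       nmem s' ''c'' = nmem s ''c'' \<and> nmem s' ''out'' = nmem s ''out'' \<and>
       filled (v + Suc j) (rmem s' ''D'') (nmem s' ''par'')) s"
    proof (rule wp_mono, rule wp_relax[OF j 2(2) s(1-3) refl refl table])
      show "\<forall>a>v + j. ?D a = 0" "?D (v + j) = 0" using fresh by auto
    next
      fix t and s' :: state
      let ?D' = "rmem s' ''D''" and ?par' = "nmem s' ''par''"
      assume *: "t \<le> (n + 1) * 90 \<and> prepared s' \<and> nmem s' ''v'' 0 = v \<and> nmem s' ''j'' 0 = j \<and>
        nmem s' ''c'' = nmem s ''c'' \<and> nmem s' ''out'' = nmem s ''out'' \<and>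
        table (v + j) ?D' ?par' \<and> (\<forall>a>v + j. ?D' a = 0) \<and> partial_entry v j n ?D' ?par'"
      then have "entry v j ?D' ?par'"
        using 2 unfolding entry_def partial_entry_def Let_def by auto
      with * have "filled (v + Suc j) ?D' ?par'" using filled_Suc v j by blast
      with * show "Suc (Suc (t + 18)) \<le> (n + 1) * 90 + 40 \<and> prepared s' \<and> nmem s' ''v'' 0 = v \<and> nmem s' ''j'' 0 = j \<and>
        nmem s' ''c'' = nmem s ''c'' \<and> nmem s' ''out'' = nmem s ''out'' \<and>
        filled (v + Suc j) ?D' ?par'" by simp
    qed
    then show ?thesis using 2 s cells by (simp add: cell_com_def) (erule wp_mono, simp)
  next
    case 3
    let ?D' = "?D(v + j := B)"
    have "table (v + j) ?D' ?par" using table table_cong[of "v + j" ?D' ?D ?par ?par] by auto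
    moreover have "entry v j ?D' ?par" using 3 unfolding entry_def Let_def by simp
    ultimately have "filled (v + Suc j) ?D' ?par"
      using filled_Suc v j fresh by simp
    then show ?thesis using 3 s cells by (simp add: cell_com_def prepared_def)
  qed
qed

lemma wp_count:
  fixes v j :: nat
  assumes j: "j < n" and v: "n dvd v"
    and s: "prepared s" "nmem s ''v'' 0 = v" "nmem s ''j'' 0 = j" "nmem s ''c'' j = v mod p (gs ! j)"
  shows "wp count_com
    (\<lambda>t s'. t \<le> 40 \<and> prepared s' \<and> nmem s' ''v'' 0 = v \<and> nmem s' ''j'' 0 = j \<and>
       nmem s' ''c'' = (nmem s ''c'')(j := (v + n) mod p (gs ! j)) \<and> nmem s' ''out'' = nmem s ''out'' \<and>
       rmem s' ''D'' = rmem s ''D'' \<and> nmem s' ''par'' = nmem s ''par'') s"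
proof -
  have "0 < p (gs ! j)" using p_eq[of "gs ! j"] w_pos[of "gs ! j"] j by simp
  then have step: "(v + n) mod p (gs ! j) = (if v mod p (gs ! j) + n < p (gs ! j) then v mod p (gs ! j) + n else 0)"
    using mod_add_step[OF v] n_dvd_p j by simp
  have cells: "nmem s ''group'' j = gs ! j" "nmem s ''top'' = p" "nmem s ''n'' 0 = n"
    using s(1) j unfolding prepared_def by auto
  show ?thesis unfolding step using s cells by (simp add: count_com_def prepared_def)
qed

definition row_ready :: "nat \<Rightarrow> (nat \<Rightarrow> nat) \<Rightarrow> state \<Rightarrow> bool" where
  "row_ready v out s \<longleftrightarrow> prepared s \<and> nmem s ''v'' 0 = v \<and> nmem s ''out'' = out \<and>
     filled v (rmem s ''D'') (nmem s ''par'') \<and> (\<forall>j<n. nmem s ''c'' j = v mod p (gs ! j))"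

lemma wp_row:
  fixes v :: nat
  assumes v: "n dvd v" and s: "row_ready v out s"
  shows "wp row_com (\<lambda>t s'. t \<le> (n + 1) * ((n + 1) * 90 + 150) \<and> row_ready (v + n) out s') s"
proof -
  \<comment> \<open>Within a row, the residues of the points before \<open>j\<close> already belong
    to row \<open>v + n\<close>, the others still to row \<open>v\<close>.\<close>
  define I where "I = (\<lambda>j s'. prepared s' \<and> nmem s' ''v'' 0 = v \<and> nmem s' ''out'' = out \<and>
     filled (v + j) (rmem s' ''D'') (nmem s' ''par'') \<and>
     (\<forall>j'<n. nmem s' ''c'' j' = (if j' < j then v + n else v) mod p (gs ! j')))"
  have "wp (for_less ''j'' (nvar ''n'') (Seq cell_com count_com))
    (\<lambda>t s'. t \<le> (n + 1) * ((n + 1) * 90 + 100 + ncost (nvar ''n'') + 13) \<and> I n s') s"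
  proof (rule wp_for_less)
    show "I 0 (nset ''j'' 0 0 s)"
      using s unfolding I_def row_ready_def prepared_def by simp
  next
    fix j s assume j: "j < n" and I: "I j s" and sj: "nmem s ''j'' 0 = j"
    have pre: "prepared s" "nmem s ''v'' 0 = v" "nmem s ''c'' j = v mod p (gs ! j)"
      "filled (v + j) (rmem s ''D'') (nmem s ''par'')"
      using I j unfolding I_def by auto
    show "wp (Seq cell_com count_com) (\<lambda>t s'. t \<le> (n + 1) * 90 + 100 \<and> nmem s' ''j'' 0 = j \<and>
        I (Suc j) (nset ''j'' 0 (Suc j) s')) s"
      unfolding wp_Seq
    proof (rule wp_mono[OF wp_cell[OF j v pre(1,2) sj pre(3,4)]])
      fix t s1
      assume 1: "t \<le> (n + 1) * 90 + 40 \<and> prepared s1 \<and> nmem s1 ''v'' 0 = v \<and> nmem s1 ''j'' 0 = j \<and>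
        nmem s1 ''c'' = nmem s ''c'' \<and> nmem s1 ''out'' = nmem s ''out'' \<and>
        filled (v + Suc j) (rmem s1 ''D'') (nmem s1 ''par'')"
      then have c1: "nmem s1 ''c'' j = v mod p (gs ! j)" using pre(3) by simp
      show "wp count_com (\<lambda>t'. (\<lambda>t s'. t \<le> (n + 1) * 90 + 100 \<and> nmem s' ''j'' 0 = j \<and>
        I (Suc j) (nset ''j'' 0 (Suc j) s')) (t + t')) s1"
        by (rule wp_mono[OF wp_count[OF j v _ _ _ c1]])
          (use 1 I in \<open>auto simp: I_def prepared_def less_Suc_eq\<close>)
    qed
  next
    show "nval (nvar ''n'') s = n" if "I j s" for j s
      using that unfolding I_def prepared_def by simp
  qed
  then show ?thesis unfolding row_com_def wp_Seq
    by (rule wp_mono) (auto simp: I_def row_ready_def prepared_def algebra_simps)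
qed

text \<open>The variant \<open>W - v\<close> counts addresses and not rows, which overestimates the
  rounds by a factor of about \<open>n\<close>; the resulting order of \<open>n ^ 3\<close> times
  the product still fits the claimed time.\<close>

lemma wp_fill:
  assumes s: "row_ready 0 out s"
  shows "wp fill_com (\<lambda>t s'. t \<le> (W + 1) * ((n + 1) * ((n + 1) * 90 + 160)) \<and> row_ready W out s') s"
proof -
  let ?T = "(n + 1) * ((n + 1) * 90 + 150)"
  define I where "I = (\<lambda>s. \<exists>v. n dvd v \<and> v \<le> W \<and> row_ready v out s)"
  have "n dvd W" using W_eq by simp
  have "wp fill_com (\<lambda>t s'. t \<le> (W - nmem s ''v'' 0 + 1) * (1 + bcost (NLess (nvar ''v'') (nvar ''W'')) + ?T)
      \<and> I s' \<and> \<not> bval (NLess (nvar ''v'') (nvar ''W'')) s') s"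
    unfolding fill_com_def
  proof (rule wp_While)
    show "I s" using s unfolding I_def by fastforce
  next
    fix s assume "I s" "bval (NLess (nvar ''v'') (nvar ''W'')) s"
    then obtain v where v: "n dvd v" "row_ready v out s" "v < W"
      unfolding I_def row_ready_def prepared_def by auto
    \<comment> \<open>Both \<open>W\<close> and \<open>v\<close> are multiples of \<open>n\<close>,
      so the rows end exactly at \<open>W\<close>.\<close>
    have "n dvd W - v" using \<open>n dvd W\<close> v(1) by simp
    then have "n \<le> W - v" using v(3) by (intro dvd_imp_le) auto
    then have "v + n \<le> W" using v(3) by simp
    show "wp row_com (\<lambda>t s'. t \<le> ?T \<and> I s' \<and> W - nmem s' ''v'' 0 < W - nmem s ''v'' 0) s"
    proof (rule wp_mono[OF wp_row[OF v(1,2)]])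
      fix t and s' :: state assume *: "t \<le> ?T \<and> row_ready (v + n) out s'"
      have "I s'" using * v(1) \<open>v + n \<le> W\<close> unfolding I_def
        by (intro exI[of _ "v + n"]) simp
      moreover have "nmem s' ''v'' 0 = v + n" "nmem s ''v'' 0 = v"
        using * v(2) unfolding row_ready_def by auto
      ultimately show "t \<le> ?T \<and> I s' \<and> W - nmem s' ''v'' 0 < W - nmem s ''v'' 0"
        using * \<open>v + n \<le> W\<close> n_pos by simp
    qed
  qed
  then show ?thesis
  proof (rule wp_mono)
    fix t and s' :: state
    assume *: "t \<le> (W - nmem s ''v'' 0 + 1) * (1 + bcost (NLess (nvar ''v'') (nvar ''W'')) + ?T)
      \<and> I s' \<and> \<not> bval (NLess (nvar ''v'') (nvar ''W'')) s'"
    then obtain v where v: "v \<le> W" "row_ready v out s'" unfolding I_def by blast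
    with * have "v = W" unfolding row_ready_def prepared_def by auto
    have "t \<le> (W + 1) * (6 + ?T)" using * by (elim conjE) (rule order.trans, assumption, simp)
    also have "\<dots> \<le> (W + 1) * ((n + 1) * ((n + 1) * 90 + 160))"
      by (rule mult_le_mono2) (simp add: algebra_simps)
    finally show "t \<le> (W + 1) * ((n + 1) * ((n + 1) * 90 + 160)) \<and> row_ready W out s'"
      using v \<open>v = W\<close> by simp
  qed
qed

section \<open>Selection, traceback and optimality\<close>

lemma wp_select:
  assumes s: "row_ready W out s" "rmem s ''D'' = D" "nmem s ''par'' = par"
  shows "wp select_com (\<lambda>t s'. t \<le> (n + 1) * 100 \<and> prepared s' \<and> nmem s' ''v'' 0 = code k \<and>
     nmem s' ''out'' = out \<and> rmem s' ''D'' = D \<and> nmem s' ''par'' = par \<and>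
     nmem s' ''i'' 0 < n \<and> (\<forall>j<n. D (code k + j) \<le> D (code k + nmem s' ''i'' 0))) s"
proof -
  define I where "I = (\<lambda>j s'. prepared s' \<and> nmem s' ''v'' 0 = code k \<and>
     nmem s' ''out'' = out \<and> rmem s' ''D'' = D \<and> nmem s' ''par'' = par \<and>
     nmem s' ''i'' 0 < n \<and> (\<forall>j'<j. D (code k + j') \<le> D (code k + nmem s' ''i'' 0)))"
  have "code k = W - n" using code_k by simp
  have *: "wp (for_less ''j'' (nvar ''n'')
      (Cond (RLess (RGet ''D'' (NAdd (nvar ''v'') (nvar ''i''))) (RGet ''D'' (NAdd (nvar ''v'') (nvar ''j''))))
        (assign ''i'' (nvar ''j'')) Skip))
    (\<lambda>t s'. t \<le> (n + 1) * (40 + ncost (nvar ''n'') + 13) \<and> I n s') s'" if "I 0 s'" for s'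
  proof (rule wp_for_less)
    show "I 0 (nset ''j'' 0 0 s')"
      using that unfolding I_def prepared_def by simp
  next
    fix j s assume j: "j < n" and I: "I j s" and sj: "nmem s ''j'' 0 = j"
    show "wp (Cond (RLess (RGet ''D'' (NAdd (nvar ''v'') (nvar ''i''))) (RGet ''D'' (NAdd (nvar ''v'') (nvar ''j''))))
        (assign ''i'' (nvar ''j'')) Skip) (\<lambda>t s'. t \<le> 40 \<and> nmem s' ''j'' 0 = j \<and>
        I (Suc j) (nset ''j'' 0 (Suc j) s')) s"
      using j I sj by (auto simp: I_def prepared_def less_Suc_eq)
  next
    show "nval (nvar ''n'') s = n" if "I j s" for j s
      using that unfolding I_def prepared_def by simp
  qed
  have "I 0 (nset ''i'' 0 0 (nset ''v'' 0 (W - n) s))"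
    using s n_pos \<open>code k = W - n\<close> unfolding I_def row_ready_def prepared_def by simp
  from *[OF this] show ?thesis
    using s unfolding select_com_def row_ready_def prepared_def
    by simp (erule wp_mono, simp add: I_def prepared_def)
qed

text \<open>Each round marks one point and moves to its predecessor by \<open>trace_step\<close>;
  the code of the missing points is the variant.\<close>

lemma wp_trace:
  assumes table: "table W D par" and "0 < d"
    and s: "prepared s" "rmem s ''D'' = D" "nmem s ''par'' = par" "nmem s ''v'' 0 = code k"
      "trace D d (code k) (nmem s ''i'' 0) {a. nmem s ''out'' a \<noteq> 0}"
  shows "wp trace_com (\<lambda>t s'. t \<le> (W + 1) * 50 \<and> feasible {a. nmem s' ''out'' a \<noteq> 0} \<and>
     separated xs d {a. nmem s' ''out'' a \<noteq> 0}) s"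
proof -
  define I where "I = (\<lambda>s. prepared s \<and> rmem s ''D'' = D \<and> nmem s ''par'' = par \<and>
     trace D d (nmem s ''v'' 0) (nmem s ''i'' 0) {a. nmem s ''out'' a \<noteq> 0})"
  let ?b = "NLess (NLit 0) (nvar ''v'')"
  have "wp trace_com (\<lambda>t s'. t \<le> (nmem s ''v'' 0 + 1) * (1 + bcost ?b + 40) \<and> I s' \<and> \<not> bval ?b s') s"
    unfolding trace_com_def
  proof (rule wp_While)
    show "I s" using s unfolding I_def by simp
  next
    fix s assume I: "I s" and b: "bval ?b s"
    let ?v = "nmem s ''v'' 0" and ?i = "nmem s ''i'' 0"
    have tr: "trace D d ?v ?i {a. nmem s ''out'' a \<noteq> 0}" and "0 < ?v"
      using I b unfolding I_def by auto
    note step = trace_step[OF tr table this(2) \<open>0 < d\<close>]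
    have "{a. ((nmem s ''out'')(?i := Suc 0)) a \<noteq> 0} = insert ?i {a. nmem s ''out'' a \<noteq> 0}"
      by auto
    with step I show "wp (Seq (NSet ''out'' (nvar ''i'') (NLit 1))
      (Seq (assign ''u'' (NGet ''par'' (NAdd (nvar ''v'') (nvar ''i''))))
      (Seq (assign ''v'' (NSub (nvar ''v'') (group_attr ''w'' ''i'')))
        (assign ''i'' (nvar ''u''))))) (\<lambda>t s'. t \<le> 40 \<and> I s' \<and> nmem s' ''v'' 0 < nmem s ''v'' 0) s"
      by (simp add: I_def prepared_def)
  qed
  then show ?thesis
  proof (rule wp_mono)
    fix t and s' :: state let ?S = "{a. nmem s' ''out'' a \<noteq> 0}"
    assume *: "t \<le> (nmem s ''v'' 0 + 1) * (1 + bcost ?b + 40) \<and> I s' \<and> \<not> bval ?b s'"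
    then have v0: "nmem s' ''v'' 0 = 0" by simp
    have "trace D d 0 (nmem s' ''i'' 0) ?S" using * unfolding I_def v0 by blast
    with trace_end[OF this] have "feasible ?S" "separated xs d ?S"
      unfolding feasible_def trace_def by blast+
    moreover have "nmem s ''v'' 0 + 1 \<le> W + 1" using s(4) code_k by simp
    then have "t \<le> (W + 1) * 50"
      using * mult_le_mono[of "nmem s ''v'' 0 + 1" "W + 1" "1 + bcost ?b + 40" 50] by simp
    ultimately show "t \<le> (W + 1) * 50 \<and> feasible ?S \<and> separated xs d ?S" by simp
  qed
qed

text \<open>The best entry of the final row dominates every threshold up to \<open>B\<close> reached
  by a feasible set, and the traceback reaches that entry. Real thresholds postpone extended reals
  to the translation into \<open>diversity\<close>.\<close>

lemma wp_solve:
  assumes "distinct xs" and "\<forall>g\<in>set gs. k g \<le> card (class {..<n} g)"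
    and s: "row_ready 0 (\<lambda>_. 0) s"
  shows "wp (Seq fill_com (Cond (NLess (nvar ''n'') (nvar ''W'')) (Seq select_com trace_com) Skip))
    (\<lambda>t s'. t \<le> (W + 1) * ((n + 1) * ((n + 1) * 500)) \<and>
       feasible {a. nmem s' ''out'' a \<noteq> 0} \<and>
       (\<forall>S t. feasible S \<longrightarrow> t \<le> B \<longrightarrow> separated xs t S \<longrightarrow>
         separated xs t {a. nmem s' ''out'' a \<noteq> 0})) s"
  (is "wp _ ?Q s")
  unfolding wp_Seq
proof (rule wp_mono[OF wp_fill[OF s]])
  fix t1 s1
  assume 1: "t1 \<le> (W + 1) * ((n + 1) * ((n + 1) * 90 + 160)) \<and> row_ready W (\<lambda>_. 0) s1"
  then have "prepared s1" and ready: "row_ready W (\<lambda>_. 0) s1" unfolding row_ready_def by auto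
  let ?M = "(W + 1) * ((n + 1) * (n + 1))"
  have M: "W + 1 \<le> ?M" "n + 1 \<le> ?M" "(W + 1) * (n + 1) \<le> ?M"
    "1 \<le> ?M" by (simp_all add: algebra_simps)
  have t1: "t1 \<le> ?M * 90 + (W + 1) * (n + 1) * 160" using 1 by (simp add: algebra_simps)
  let ?D = "rmem s1 ''D''" and ?par = "nmem s1 ''par''"
  have table: "table W ?D ?par" using ready unfolding row_ready_def filled_def by blast
  show "wp (Cond (NLess (nvar ''n'') (nvar ''W'')) (Seq select_com trace_com) Skip) (\<lambda>t'. ?Q (t1 + t')) s1"
  proof (cases "n < W")
    case False
    \<comment> \<open>No point is requested, so the output stays empty and satisfies every
      threshold.\<close>
    then have "code k = 0" using code_k by linarith
    then have "\<forall>g\<in>set gs. k g = 0" using code_eq_0 by blast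
    then have "feasible {}" unfolding feasible_def by simp
    moreover have "{a. nmem s1 ''out'' a \<noteq> 0} = {}" using ready unfolding row_ready_def by simp
    moreover have "t1 + 8 \<le> (W + 1) * ((n + 1) * ((n + 1) * 500))"
      using t1 M unfolding mult.assoc[symmetric] by linarith
    ultimately show ?thesis using False \<open>prepared s1\<close>
      by (simp add: prepared_def separated_def)
  next
    case True
    have "wp (Seq select_com trace_com) (\<lambda>t'. ?Q (t1 + (6 + t'))) s1"
      unfolding wp_Seq
    proof (rule wp_mono[OF wp_select[OF ready refl refl]])
      fix t2 and s2 :: state
      let ?i = "nmem s2 ''i'' 0" let ?d = "?D (code k + ?i)"
      assume 2: "t2 \<le> (n + 1) * 100 \<and> prepared s2 \<and> nmem s2 ''v'' 0 = code k \<and>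
        nmem s2 ''out'' = (\<lambda>_. 0) \<and> rmem s2 ''D'' = ?D \<and> nmem s2 ''par'' = ?par \<and>
        ?i < n \<and> (\<forall>j<n. ?D (code k + j) \<le> ?d)"
      then have best: "\<forall>j<n. ?D (code k + j) \<le> ?d" by blast
      note best = feasible_le_best[OF table this True]
      obtain S where S: "feasible S" using ex_feasible[OF assms(2)] by blast
      then have "S \<subseteq> {..<length xs}" unfolding feasible_def length_xs by blast
      with ex_separated[OF _ this \<open>distinct xs\<close> B_pos] obtain t
        where "0 < t" "t \<le> B" "separated xs t S" using finite_subset by blast
      \<comment> \<open>A feasible set reaches some positive threshold, hence the best entry exceeds
        the marker 0.\<close>
      with best[OF S] have "0 < ?d" by fastforce
      have start: "trace ?D ?d (code k) ?i {a. nmem s2 ''out'' a \<noteq> 0}"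
        using 2 trace_start by simp
      show "wp trace_com (\<lambda>t3. ?Q (t1 + (6 + (t2 + t3)))) s2"
      proof (rule wp_mono[OF wp_trace[OF table \<open>0 < ?d\<close> _ _ _ _ start]])
        fix t3 and s3 :: state let ?S = "{a. nmem s3 ''out'' a \<noteq> 0}"
        assume 3: "t3 \<le> (W + 1) * 50 \<and> feasible ?S \<and> separated xs ?d ?S"
        \<comment> \<open>Products become variables dominated by \<open>q\<close>, which leaves a
          linear goal: 90 + 160 + 6 + 100 + 50 is below 500.\<close>
        have sum: "t1 + (6 + (t2 + t3)) \<le> q * 500"
          if "t1 \<le> q * 90 + r * 160" "t2 \<le> a * 100" "t3 \<le> b * 50" "b \<le> q" "a \<le> q" "r \<le> q" "1 \<le> q"
          for q r a b using that by linarith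
        have "t1 + (6 + (t2 + t3)) \<le> (W + 1) * ((n + 1) * ((n + 1) * 500))"
          using sum[OF t1 conjunct1[OF 2] conjunct1[OF 3] M] by (simp only: mult.assoc)
        moreover have "separated xs t ?S" if "feasible S" "t \<le> B" "separated xs t S" for S t
          using best[OF that] 3 unfolding separated_def by (meson order.trans)
        ultimately show "?Q (t1 + (6 + (t2 + t3))) s3" using 3 by blast
      qed (use 2 in auto)
    qed
    then show ?thesis using True \<open>prepared s1\<close>
      by (simp add: prepared_def)
  qed
qed

end

section \<open>Correctness and running time\<close>

definition weights_ready :: "nat \<Rightarrow> (nat \<Rightarrow> nat) \<Rightarrow> real list \<Rightarrow> nat list \<Rightarrow> nat \<Rightarrow> state \<Rightarrow> bool" where
  "weights_ready n k xs gs j s \<longleftrightarrow>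
     nmem s ''n'' 0 = n \<and> (\<forall>i<n. nmem s ''group'' i = gs ! i \<and> rmem s ''x'' i = xs ! i) \<and>
     (\<forall>g\<in>set gs. nmem s ''k'' g = k g) \<and> nmem s ''v'' 0 = 0 \<and> nmem s ''c'' = (\<lambda>_. 0) \<and>
     nmem s ''out'' = (\<lambda>_. 0) \<and> rmem s ''D'' = (\<lambda>_. 0) \<and>
     weights n k (set (take j gs)) (nmem s ''w'') (nmem s ''top'') (nmem s ''W'' 0) \<and>
     (\<forall>g. g \<notin> set (take j gs) \<longrightarrow> nmem s ''w'' g = 0) \<and>
     rmem s ''B'' 0 = 1 + (\<Sum>i<j. xs ! i * xs ! i)"

text \<open>The bound \<open>k g \<le> n\<close> limits the repeated additions, so the work for one
  point is linear in \<open>n\<close>.\<close>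

lemma wp_weights_cell:
  assumes gs: "length gs = n" and k: "\<forall>g\<in>set gs. k g \<le> n" and j: "j < n"
    and s: "weights_ready n k xs gs j s" "nmem s ''j'' 0 = j"
  shows "wp weights_cell_com
      (\<lambda>t s'. t \<le> (n + 1) * 30 + 50 \<and> nmem s' ''j'' 0 = j \<and> weights_ready n k xs gs (Suc j) s') s"
proof -
  define g where "g = gs ! j"
  let ?A = "set (take j gs)"
  have g: "g \<in> set gs" using j gs unfolding g_def by simp
  have take: "set (take (Suc j) gs) = insert g ?A"
    using j gs unfolding g_def by (simp add: take_Suc_conv_app_nth)
  have cells: "nmem s ''group'' j = g" "rmem s ''x'' j = xs ! j" "nmem s ''k'' g = k g"
    using s(1) j g unfolding weights_ready_def g_def by auto
  have wts: "weights n k ?A (nmem s ''w'') (nmem s ''top'') (nmem s ''W'' 0)"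
    using s(1) unfolding weights_ready_def by blast
  \<comment> \<open>This is the test made by the program: unseen groups still have the initial 0,
    seen ones a positive weight.\<close>
  have seen: "0 < nmem s ''w'' g \<longleftrightarrow> g \<in> ?A"
  proof (cases "g \<in> ?A")
    case True
    then show ?thesis using wts unfolding weights_def by blast
  next
    case False
    then have "nmem s ''w'' g = 0" using s(1) unfolding weights_ready_def by blast
    with False show ?thesis by simp
  qed
  show ?thesis
  proof (cases "g \<in> ?A")
    case True
    then have "set (take (Suc j) gs) = ?A" using take by auto
    then show ?thesis using True s seen cells by (simp add: weights_cell_com_def weights_ready_def)
  next
    case False
    define W where "W = nmem s ''W'' 0"
    define s1 where "s1 = nset ''w'' g W (rset ''B'' 0 (rmem s ''B'' 0 + xs ! j * xs ! j) s)"
    \<comment> \<open>The loop state is described exactly: after \<open>i\<close> additions it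
      differs from \<open>s1\<close> only in \<open>W\<close> and in the counter, whose value is
      some \<open>u\<close>.\<close>
    define I where "I = (\<lambda>i s'. (\<exists>u. s' = nset ''W'' 0 (W * (i + 1)) (nset ''i'' 0 u s1)))"
    have "wp (for_less ''i'' (group_attr ''k'' ''j'')
        (assign ''W'' (NAdd (nvar ''W'') (group_attr ''w'' ''j''))))
      (\<lambda>t s'. t \<le> (k g + 1) * (11 + ncost (group_attr ''k'' ''j'') + 13) \<and> I (k g) s') s1"
    proof (rule wp_for_less)
      have "nset ''i'' 0 0 s1 = nset ''W'' 0 (W * (0 + 1)) (nset ''i'' 0 0 s1)"
        unfolding s1_def nset_def rset_def W_def by (simp add: fun_eq_iff)
      then show "I 0 (nset ''i'' 0 0 s1)" unfolding I_def by blast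
    next
      fix i s' assume "I i s'" and "nmem s' ''i'' 0 = i"
      then obtain u where u: "s' = nset ''W'' 0 (W * (i + 1)) (nset ''i'' 0 u s1)"
        unfolding I_def by blast
      then have "u = i" using \<open>nmem s' ''i'' 0 = i\<close> by simp
      note s' = u[unfolded this]
      have eq: "nset ''i'' 0 (Suc i) (nset ''W'' 0 (W * (i + 1) + W) s') =
          nset ''W'' 0 (W * (Suc i + 1)) (nset ''i'' 0 (Suc i) s1)"
        unfolding s' by (simp add: nset_def fun_eq_iff)
      then have "I (Suc i) (nset ''i'' 0 (Suc i) (nset ''W'' 0 (W * (i + 1) + W) s'))"
        unfolding I_def by blast
      then show "wp (assign ''W'' (NAdd (nvar ''W'') (group_attr ''w'' ''j'')))
        (\<lambda>t s'. t \<le> 11 \<and> nmem s' ''i'' 0 = i \<and> I (Suc i) (nset ''i'' 0 (Suc i) s')) s'"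
        using s(2) cells unfolding s' s1_def by simp
    next
      show "nval (group_attr ''k'' ''j'') s' = k g" if "I i s'" for i s'
        using that s(2) cells unfolding I_def s1_def by auto
    qed
    then have *: "wp (for_less ''i'' (group_attr ''k'' ''j'')
        (assign ''W'' (NAdd (nvar ''W'') (group_attr ''w'' ''j''))))
      (\<lambda>t s'. t \<le> (n + 1) * 30 \<and> I (k g) s') s1"
    proof (rule wp_mono)
      fix t and s' :: state
      assume *: "t \<le> (k g + 1) * (11 + ncost (group_attr ''k'' ''j'') + 13) \<and> I (k g) s'"
      have "(k g + 1) * (11 + ncost (group_attr ''k'' ''j'') + 13) \<le> (n + 1) * 30"
        using k g by (intro mult_le_mono) auto
      with * show "t \<le> (n + 1) * 30 \<and> I (k g) s'" by linarith
    qed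
    have n: "0 < n" using j by simp
    note wts' = weights_insert[OF wts False n, folded W_def]
    have "wp (for_less ''i'' (group_attr ''k'' ''j'')
        (assign ''W'' (NAdd (nvar ''W'') (group_attr ''w'' ''j''))))
      (\<lambda>t s'. t + 40 \<le> (n + 1) * 30 + 50 \<and> nmem s' ''group'' j = g \<and> nmem s' ''j'' 0 = j \<and>
        weights_ready n k xs gs (Suc j) (nset ''top'' g (nmem s' ''W'' 0) s')) s1"
      using *
    proof (rule wp_mono)
      fix t and s' :: state
      assume 1: "t \<le> (n + 1) * 30 \<and> I (k g) s'"
      then obtain u where s': "s' = nset ''W'' 0 (W * (k g + 1)) (nset ''i'' 0 u s1)"
        unfolding I_def by blast
      show "t + 40 \<le> (n + 1) * 30 + 50 \<and> nmem s' ''group'' j = g \<and> nmem s' ''j'' 0 = j \<and>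
        weights_ready n k xs gs (Suc j) (nset ''top'' g (nmem s' ''W'' 0) s')"
        using 1 s wts' cells unfolding s' s1_def by (simp add: weights_ready_def take)
    qed
    then show ?thesis
      using s(2) cells seen False
      by (simp add: weights_cell_com_def s1_def[symmetric] W_def[symmetric]) (erule wp_mono, simp)
  qed
qed

lemma wp_weights:
  assumes gs: "length gs = n" and k: "\<forall>g\<in>set gs. k g \<le> n"
    and s: "weights_ready n k xs gs 0 (rset ''B'' 0 1 (nset ''W'' 0 n s))" "nmem s ''n'' 0 = n"
  shows "wp weights_com (\<lambda>t s'. t \<le> (n + 1) * ((n + 1) * 120) \<and> weights_ready n k xs gs n s') s"
proof -
  have ignore_j: "weights_ready n k xs gs i (nset ''j'' 0 u s) = weights_ready n k xs gs i s" for i u s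
    by (simp add: weights_ready_def)
  have "wp (for_less ''j'' (nvar ''n'') weights_cell_com)
     (\<lambda>t s'. t \<le> (n + 1) * ((n + 1) * 30 + 50 + ncost (nvar ''n'') + 13) \<and> weights_ready n k xs gs n s')
     (rset ''B'' 0 1 (nset ''W'' 0 n s))"
  proof (rule wp_for_less[where I = "weights_ready n k xs gs"])
    show "weights_ready n k xs gs 0 (nset ''j'' 0 0 (rset ''B'' 0 1 (nset ''W'' 0 n s)))"
      using s unfolding ignore_j by simp
  next
    show "wp weights_cell_com (\<lambda>t s'. t \<le> (n + 1) * 30 + 50 \<and> nmem s' ''j'' 0 = j \<and>
        weights_ready n k xs gs (Suc j) (nset ''j'' 0 (Suc j) s')) s"
      if "j < n" "weights_ready n k xs gs j s" "nmem s ''j'' 0 = j" for j s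
      unfolding ignore_j by (rule wp_weights_cell[OF gs k that])
  next
    show "nval (nvar ''n'') s = n" if "weights_ready n k xs gs j s" for j s
      using that unfolding weights_ready_def by simp
  qed
  then show ?thesis
    using s(2) unfolding weights_com_def by simp (erule wp_mono, simp add: algebra_simps)
qed

section \<open>From separation to diversity\<close>

text \<open>If some pair of \<open>S\<close> were closer than \<open>diversity S'\<close>, a real
  \<open>t\<close> between the two values would separate \<open>I'\<close> but not \<open>I\<close>.
  As distances stay below \<open>B\<close>, such a \<open>t\<close> exists below the cap, even when
  \<open>diversity S'\<close> is infinite.\<close>

lemma diversity_le_if_separated:
  assumes xs: "S = (!) xs ` I" "S' = (!) xs ` I'" "inj_on ((!) xs) I'"
    and close: "\<And>a b. a \<in> I \<Longrightarrow> b \<in> I \<Longrightarrow> \<bar>xs ! a - xs ! b\<bar> < B"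
    and sep: "\<And>t. t \<le> B \<Longrightarrow> separated xs t I' \<Longrightarrow> separated xs t I"
  shows "diversity S' \<le> diversity S"
  unfolding diversity_def[of S]
proof (rule INF_greatest, clarify)
  fix u v assume "u \<in> S" "v \<in> S" "u \<noteq> v"
  then obtain a b where ab: "a \<in> I" "b \<in> I" "a \<noteq> b" "u = xs ! a" "v = xs ! b"
    using xs(1) by auto
  show "diversity S' \<le> ereal (dist u v)"
  proof (rule ccontr)
    assume "\<not> diversity S' \<le> ereal (dist u v)"
    moreover have "dist u v < B" using close ab by (simp add: dist_real_def)
    ultimately have "ereal (dist u v) < min (ereal B) (diversity S')" by simp
    then obtain t where t: "ereal (dist u v) < ereal t" "ereal t < min (ereal B) (diversity S')"
      using ereal_dense2 by blast
    have "separated xs t I'"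
      unfolding separated_def
    proof (intro ballI impI)
      fix a' b' assume "a' \<in> I'" "b' \<in> I'" "a' \<noteq> b'"
      then have "(xs ! a', xs ! b') \<in> {(u, v). u \<in> S' \<and> v \<in> S' \<and> u \<noteq> v}"
        using xs(2,3) by (auto dest: inj_onD)
      from INF_lower[OF this, of "\<lambda>(u, v). ereal (dist u v)"]
      have "diversity S' \<le> ereal (dist (xs ! a') (xs ! b'))"
        unfolding diversity_def by simp
      with t(2) have "ereal t < ereal (dist (xs ! a') (xs ! b'))"
        by (meson min_less_iff_conj less_le_trans)
      then show "t \<le> \<bar>xs ! a' - xs ! b'\<bar>" by (simp add: dist_real_def)
    qed
    with sep[of t] t(2) have "separated xs t I" by simp
    with ab have "t \<le> dist u v" unfolding separated_def by (simp add: dist_real_def)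
    with t(1) show False by simp
  qed
qed

lemma card_presented:
  assumes "distinct xs" and "J \<subseteq> {..<length xs}"
    and "\<And>j. j < length xs \<Longrightarrow> xs ! j \<in> G \<longleftrightarrow> gs ! j = (g :: nat)"
  shows "card ((!) xs ` J \<inter> G) = card {j \<in> J. gs ! j = g}"
proof -
  have "(!) xs ` J \<inter> G = (!) xs ` {j \<in> J. gs ! j = g}" using assms(2,3) by auto
  moreover have "inj_on ((!) xs) {j \<in> J. gs ! j = g}"
    using assms(1,2) by (intro inj_on_nth) auto
  ultimately show ?thesis by (simp add: card_image)
qed

text \<open>By \<open>2 * \<bar>x\<bar> \<le> 1 + x * x\<close> at both points, the distance is at
  most 1 plus half the sum of the two squares; distinct values are not both 0, which makes the bound
  strict.\<close>

lemma dist_less_sum_squares: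
  fixes f :: "nat \<Rightarrow> real"
  assumes "a < n" and "b < n"
  shows "\<bar>f a - f b\<bar> < 1 + (\<Sum>i<n. f i * f i)"
proof -
  have nonneg: "0 \<le> (\<Sum>i<n. f i * f i)" by (intro sum_nonneg) simp
  show ?thesis
  proof (cases "f a = f b")
    case True
    with nonneg show ?thesis by simp
  next
    case False
    then have "(\<Sum>i\<in>{a, b}. f i * f i) = f a * f a + f b * f b" by (cases "a = b") auto
    moreover have "(\<Sum>i\<in>{a, b}. f i * f i) \<le> (\<Sum>i<n. f i * f i)"
      using assms by (intro sum_mono2) auto
    ultimately have sum: "f a * f a + f b * f b \<le> (\<Sum>i<n. f i * f i)" by linarith
    have sq: "2 * \<bar>x\<bar> \<le> 1 + x * x" for x :: real
      using zero_le_power2[of "\<bar>x\<bar> - 1"] by (simp add: power2_eq_square algebra_simps)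
    have double: "2 * d \<le> 2 + (p + q)" if "2 * y \<le> 1 + p" "2 * z \<le> 1 + q" "d \<le> y + z"
      for d y z p q :: real using that by linarith
    have "2 * \<bar>f a - f b\<bar> \<le> 2 + (f a * f a + f b * f b)"
      by (rule double[OF sq sq abs_triangle_ineq4])
    moreover have "0 < f a * f a + f b * f b"
      using False by (auto simp: sum_squares_gt_zero_iff)
    moreover have "d < 1 + q" if "2 * d \<le> 2 + p" "0 < p" "p \<le> q" for d p q :: real
      using that by linarith
    ultimately show ?thesis using sum by blast
  qed
qed

section \<open>The whole program and the final bound\<close>

definition group_counts :: "nat list \<Rightarrow> (nat \<Rightarrow> nat) \<Rightarrow> nat set \<Rightarrow> bool" where
  "group_counts gs k S \<longleftrightarrow> S \<subseteq> {..<length gs} \<and> (\<forall>g\<in>set gs. card {i \<in> S. gs ! i = g} = k g)"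

text \<open>\<open>group_counts\<close> restates \<open>feasible\<close> outside the locale, so that
  the empty input, which the locale excludes, is covered too.\<close>

lemma wp_fair:
  assumes lengths: "length xs = n" "length gs = n" and "distinct xs"
    and k: "\<forall>g\<in>set gs. k g \<le> card {i \<in> {..<n}. gs ! i = g}"
    and s: "weights_ready n k xs gs 0 (rset ''B'' 0 1 (nset ''W'' 0 n s))" "nmem s ''n'' 0 = n"
  defines "W \<equiv> n * (\<Prod>g\<in>set gs. k g + 1)"
  shows "wp fair_com (\<lambda>t s'. t \<le> (W + 1) * ((n + 1) * ((n + 1) * 700)) \<and>
       group_counts gs k {a. nmem s' ''out'' a \<noteq> 0} \<and>
       (\<forall>S t. group_counts gs k S \<longrightarrow> t \<le> 1 + (\<Sum>i<n. xs ! i * xs ! i) \<longrightarrow> separated xs t S \<longrightarrow>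
         separated xs t {a. nmem s' ''out'' a \<noteq> 0})) s"
proof -
  define B where "B = 1 + (\<Sum>i<n. xs ! i * xs ! i)"
  have "0 < B" unfolding B_def by (intro add_pos_nonneg sum_nonneg) auto
  let ?Q = "\<lambda>t s'. t \<le> (W + 1) * ((n + 1) * ((n + 1) * 500)) \<and>
       group_counts gs k {a. nmem s' ''out'' a \<noteq> 0} \<and>
       (\<forall>S t. group_counts gs k S \<longrightarrow> t \<le> B \<longrightarrow> separated xs t S \<longrightarrow>
         separated xs t {a. nmem s' ''out'' a \<noteq> 0})"
  let ?c = "Seq fill_com (Cond (NLess (nvar ''n'') (nvar ''W'')) (Seq select_com trace_com) Skip)"
  have k_le: "\<forall>g\<in>set gs. k g \<le> n"
  proof
    fix g assume "g \<in> set gs"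
    have "card {i \<in> {..<n}. gs ! i = g} \<le> card {..<n}" by (intro card_mono) auto
    with k \<open>g \<in> set gs\<close> show "k g \<le> n" by fastforce
  qed
  have solve: "wp ?c ?Q s'" if s': "weights_ready n k xs gs n s'" for s'
  proof (cases "n = 0")
    case True
    \<comment> \<open>Without points \<open>W\<close> is 0, so the table loop stops at its first
      test.\<close>
    then have W: "nmem s' ''W'' 0 = 0"
      using s' lengths unfolding weights_ready_def weights_def by simp
    have "exec fill_com s' (1 + bcost (NLess (nvar ''v'') (nvar ''W''))) s'"
      unfolding fill_com_def by (rule exec.WhileFalse) (simp add: W)
    then have "exec fill_com s' 6 s'" by (simp add: eval_nat_numeral)
    then have fill: "wp fill_com R s'" if "R 6 s'" for R using that unfolding wp_def by blast
    show ?thesis unfolding wp_Seq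
      by (rule fill) (use True W s' lengths in \<open>simp add: weights_ready_def group_counts_def separated_def\<close>)
  next
    case False
    let ?w = "nmem s' ''w''" and ?p = "nmem s' ''top''"
    have wts: "weights n k (set gs) ?w ?p (nmem s' ''W'' 0)"
      using s' lengths unfolding weights_ready_def by simp
    then have W: "nmem s' ''W'' 0 = W" unfolding weights_def W_def by blast
    interpret weighted_points n k xs gs ?w ?p W B
      using wts False lengths \<open>0 < B\<close> unfolding W by unfold_locales auto
    have "row_ready 0 (\<lambda>_. 0) s'"
      using s' W unfolding row_ready_def prepared_def filled_def table_def weights_ready_def
      by (simp add: B_def)
    moreover have "feasible = group_counts gs k"
      unfolding feasible_def group_counts_def fun_eq_iff using lengths by simp
    ultimately show ?thesis using wp_solve[OF \<open>distinct xs\<close> k] by (simp only:)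
  qed
  show ?thesis unfolding fair_com_def wp_Seq[of weights_com]
  proof (rule wp_mono[OF wp_weights[OF lengths(2) k_le s]])
    fix t1 s1 assume 1: "t1 \<le> (n + 1) * ((n + 1) * 120) \<and> weights_ready n k xs gs n s1"
    have M: "(n + 1) * (n + 1) \<le> (W + 1) * ((n + 1) * (n + 1))" by simp
    have t1: "t1 \<le> (n + 1) * (n + 1) * 120" using 1 by (simp only: mult.assoc)
    show "wp ?c (\<lambda>t'. (\<lambda>t s'. t \<le> (W + 1) * ((n + 1) * ((n + 1) * 700)) \<and>
       group_counts gs k {a. nmem s' ''out'' a \<noteq> 0} \<and>
       (\<forall>S t. group_counts gs k S \<longrightarrow> t \<le> 1 + (\<Sum>i<n. xs ! i * xs ! i) \<longrightarrow> separated xs t S \<longrightarrow>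
         separated xs t {a. nmem s' ''out'' a \<noteq> 0})) (t1 + t')) s1"
    proof (rule wp_mono[OF solve[OF conjunct2[OF 1]]])
      fix t2 s2 assume 2: "?Q t2 s2"
      have "t1 + t2 \<le> (W + 1) * ((n + 1) * ((n + 1) * 700))"
        using t1 conjunct1[OF 2] M unfolding mult.assoc[symmetric] by linarith
      then show "t1 + t2 \<le> (W + 1) * ((n + 1) * ((n + 1) * 700)) \<and>
       group_counts gs k {a. nmem s2 ''out'' a \<noteq> 0} \<and>
       (\<forall>S t. group_counts gs k S \<longrightarrow> t \<le> 1 + (\<Sum>i<n. xs ! i * xs ! i) \<longrightarrow> separated xs t S \<longrightarrow>
         separated xs t {a. nmem s2 ''out'' a \<noteq> 0})"
        using 2 unfolding B_def by blast
    qed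
  qed
qed

lemma fair_com_correct:
  assumes inst: "fair_instance m X G k" and pres: "presents m X G xs gs"
  shows "\<exists>t s. exec fair_com (input_state m k xs gs) t s \<and>
    output_set xs s \<in> fair_sets m X G k \<and> diversity (output_set xs s) = opt_diversity m X G k \<and>
    (card X \<ge> 1 \<longrightarrow> t \<le> 11200 * (card X ^ 4 * (\<Prod>i<m. (k i + 1))))"
proof -
  define n where "n = length xs"
  define B where "B = 1 + (\<Sum>i<n. xs ! i * xs ! i)"
  have xs: "distinct xs" "set xs = X" "length xs = n" "length gs = n"
    and gs: "\<And>j. j < n \<Longrightarrow> gs ! j < m \<and> xs ! j \<in> G (gs ! j)"
    using pres unfolding presents_def n_def by auto
  have X: "finite X" "X = (\<Union>i<m. G i)" "\<And>i. i < m \<Longrightarrow> k i \<le> card (G i)"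
    and disj: "disjoint_family_on G {..<m}"
    using inst unfolding fair_instance_def by auto
  have card_X: "card X = n" using xs distinct_card by metis
  have image_xs: "(!) xs ` {..<n} = X" using xs by (auto simp: set_conv_nth)
  \<comment> \<open>Disjointness turns the listed group of a point into its only group.\<close>
  have in_G: "xs ! j \<in> G i \<longleftrightarrow> gs ! j = i" if "j < length xs" "i < m" for j i
    using gs[of j] that disj xs(3) unfolding disjoint_family_on_def by blast
  have card_class: "card ((!) xs ` J \<inter> G i) = card {j \<in> J. gs ! j = i}"
    if "J \<subseteq> {..<n}" "i < m" for J i
    using card_presented[OF xs(1) _ in_G] that xs(3) by simp
  have k_le: "k i \<le> card {j \<in> {..<n}. gs ! j = i}" if "i < m" for i
  proof -
    have "(!) xs ` {..<n} \<inter> G i = G i" using that X(2) unfolding image_xs by auto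
    then show ?thesis using card_class[OF order.refl that] X(3)[OF that] by simp
  qed
  have unseen: "{j \<in> J. gs ! j = i} = {}" if "i \<notin> set gs" "J \<subseteq> {..<n}" for i J
    using that xs(4) by force
  \<comment> \<open>A group without points has \<open>k i = 0\<close>, so restricting to the groups
    that occur loses no constraint and only factors 1 of the product.\<close>
  have k_0: "k i = 0" if "i < m" "i \<notin> set gs" for i
    using k_le[OF that(1)] unfolding unseen[OF that(2) order.refl] by simp
  have set_gs: "set gs \<subseteq> {..<m}" using gs xs(4) by (auto simp: in_set_conv_nth)
  have fair: "(!) xs ` J \<in> fair_sets m X G k \<longleftrightarrow> group_counts gs k J" if J: "J \<subseteq> {..<n}" for J
  proof -
    have "(!) xs ` J \<subseteq> X" using J image_xs by auto
    then have "(!) xs ` J \<in> fair_sets m X G k \<longleftrightarrow> (\<forall>i<m. card {j \<in> J. gs ! j = i} = k i)"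
      unfolding fair_sets_def using card_class[OF J] by simp
    also have "\<dots> \<longleftrightarrow> (\<forall>g\<in>set gs. card {j \<in> J. gs ! j = g} = k g)"
      (is "?L \<longleftrightarrow> ?R")
    proof
      assume ?L then show ?R using set_gs by blast
    next
      assume R: ?R
      show ?L
      proof (intro allI impI)
        fix i assume "i < m"
        show "card {j \<in> J. gs ! j = i} = k i"
        proof (cases "i \<in> set gs")
          case False
          then show ?thesis unfolding unseen[OF False J] k_0[OF \<open>i < m\<close> False] by simp
        qed (use R in blast)
      qed
    qed
    finally show ?thesis unfolding group_counts_def using J xs(4) by simp
  qed
  have prod: "(\<Prod>g\<in>set gs. k g + 1) = (\<Prod>i<m. k i + 1)"
    using set_gs k_0 by (intro prod.mono_neutral_left) auto
  let ?s = "input_state m k xs gs"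
  have start: "weights_ready n k xs gs 0 (rset ''B'' 0 1 (nset ''W'' 0 n ?s))"
    using xs set_gs by (auto simp: weights_ready_def input_state_def weights_empty)
  have n: "nmem ?s ''n'' 0 = n" using xs by (simp add: input_state_def)
  have k: "\<forall>g\<in>set gs. k g \<le> card {i \<in> {..<n}. gs ! i = g}" using k_le set_gs by blast
  obtain t s where exec: "exec fair_com ?s t s"
    and post: "t \<le> (n * (\<Prod>i<m. k i + 1) + 1) * ((n + 1) * ((n + 1) * 700)) \<and>
      group_counts gs k {a. nmem s ''out'' a \<noteq> 0} \<and>
      (\<forall>S t. group_counts gs k S \<longrightarrow> t \<le> B \<longrightarrow> separated xs t S \<longrightarrow>
        separated xs t {a. nmem s ''out'' a \<noteq> 0})"
    using wp_fair[OF xs(3,4,1) k start n, folded B_def] unfolding wp_def prod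
    by (elim exE) (erule conjE, rule that)
  note t = conjunct1[OF post] and counts = conjunct1[OF conjunct2[OF post]]
    and opt = conjunct2[OF conjunct2[OF post], rule_format]
  define I where "I = {a. nmem s ''out'' a \<noteq> 0}"
  have I: "I \<subseteq> {..<n}" using counts xs(4) unfolding group_counts_def I_def by simp
  then have out: "output_set xs s = (!) xs ` I"
    unfolding output_set_def I_def xs(3) by auto
  have out_fair: "output_set xs s \<in> fair_sets m X G k"
    unfolding out fair[OF I] using counts unfolding I_def .
  have "diversity S \<le> diversity (output_set xs s)" if S: "S \<in> fair_sets m X G k" for S
  proof -
    let ?J = "{j \<in> {..<n}. xs ! j \<in> S}"
    have "S \<subseteq> (!) xs ` {..<n}" using S unfolding image_xs fair_sets_def by blast
    then have J: "S = (!) xs ` ?J" by auto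
    then have "group_counts gs k ?J" using fair[of ?J] S by auto
    then have "\<And>t. t \<le> B \<Longrightarrow> separated xs t ?J \<Longrightarrow> separated xs t I"
      using opt unfolding I_def by blast
    moreover have "inj_on ((!) xs) ?J" using xs by (intro inj_on_nth) auto
    moreover have "\<bar>xs ! a - xs ! b\<bar> < B" if "a \<in> I" "b \<in> I" for a b
      using dist_less_sum_squares[of a n b "(!) xs"] that I unfolding B_def by auto
    ultimately show ?thesis using diversity_le_if_separated[OF out J] by blast
  qed
  moreover have "finite (fair_sets m X G k)"
    by (rule finite_subset[of _ "Pow X"]) (use X(1) in \<open>auto simp: fair_sets_def\<close>)
  ultimately have "diversity (output_set xs s) = opt_diversity m X G k"
    unfolding opt_diversity_def using out_fair by (intro Max_eqI[symmetric]) auto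
  moreover have "t \<le> 11200 * (card X ^ 4 * (\<Prod>i<m. (k i + 1)))" if "card X \<ge> 1"
  proof -
    let ?K = "\<Prod>i<m. k i + 1"
    have n: "1 \<le> n" using that card_X by simp
    have K: "1 \<le> ?K" by (intro prod_ge_1) auto
    have nK: "1 \<le> n * ?K" using mult_le_mono[OF n K] by simp
    \<comment> \<open>For \<open>n \<ge> 1\<close> the factors \<open>n * ?K + 1\<close> and
      \<open>n + 1\<close> are at most twice \<open>n * ?K\<close> and \<open>n\<close>, and 700 is
      rounded up to 1400, so the constant is 8 * 1400 = 11200. The cubic bound is then relaxed to
      \<open>n ^ 4\<close>.\<close>
    have "(n * ?K + 1) * ((n + 1) * ((n + 1) * 700)) \<le> (2 * (n * ?K)) * ((2 * n) * ((2 * n) * 1400))"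
      using n nK by (intro mult_le_mono) auto
    also have "\<dots> = 11200 * (n ^ 3 * ?K)" by (simp add: power3_eq_cube)
    also have "\<dots> \<le> 11200 * (n ^ 4 * ?K)"
      using n by (intro mult_le_mono2 mult_le_mono1 power_increasing) auto
    finally show ?thesis using t unfolding card_X by linarith
  qed
  ultimately show ?thesis using exec out_fair by blast
qed

theorem theorem4:
  shows "\<exists>(P :: com) (C :: nat).
    \<forall>(m :: nat) (X :: real set) (G :: nat \<Rightarrow> real set) (k :: nat \<Rightarrow> nat) (xs :: real list) (gs :: nat list).
      fair_instance m X G k \<and> presents m X G xs gs \<longrightarrow>
      (\<exists>t s. exec P (input_state m k xs gs) t s \<and>
             output_set xs s \<in> fair_sets m X G k \<and>
             diversity (output_set xs s) = opt_diversity m X G k \<and>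
             (card X \<ge> 1 \<longrightarrow> t \<le> C * (card X ^ 4 * (\<Prod>i<m. (k i + 1)))))"
  using fair_com_correct by blast

end
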